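(* Let $H$ be an infinite dimensional real separable Hilbert space and $G$ a compact Lie group acting orthogonally on $H$. Let $L=\{L_\lambda\}_{\lambda\in I}$, $I=[0,1]$, be a path in $\mathcal{FS}^i(H)^G$. Then there are a $G$-equivariant symmetry $Q\in\mathcal{FS}^i(H)^G$ and paths $M=\{M_\lambda\}_{\lambda\in I}$ in $\mathrm{GL}(H)^G$ and $K=\{K_\lambda\}_{\lambda\in I}$ in $\mathcal{KS}(H)^G$ such that \[M_\lambda^\ast L_\lambda M_\lambda=Q+K_\lambda,\qquad \lambda\in I.\]
   Context: Orthogonal action: a continuous action $G\times H\to H$ by linear orthogonal operators. An operator $T$ is $G$-equivariant if $T(gu)=g(Tu)$ for all $g\in G$, $u\in H$; a superscript $G$ on a set of operators denotes its subset of $G$-equivariant elements. All sets of operators carry the norm topology, and a path is a norm-continuous family parametrised by $I$. $\mathcal{FS}(H)$ is the set of bounded selfadjoint Fredholm operators on $H$. $\mathcal{FS}^+(H)$ (resp. $\mathcal{FS}^-(H)$) is the set of those $T\in\mathcal{FS}(H)$ whose essential spectrum $\{\mu\in\mathbb{R}:\mu-T\text{ not Fredholm}\}$ is contained in $(0,\infty)$ (resp. $(-\infty,0)$), and $\mathcal{FS}^i(H)=\mathcal{FS}(H)\setminus(\mathcal{FS}^+(H)\cup\mathcal{FS}^-(H))$. $\mathcal{KS}(H)$ is the set of compact selfadjoint operators and $\mathrm{GL}(H)$ the set of bounded invertible operators on $H$. A symmetry is an operator of the form $Q=P-(I_H-P)=2P-I_H$, where $P$ is an orthogonal projection with infinite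 dimensional kernel and range. *)

theory Defs
  imports "HOL-Analysis.Analysis" "HOL-Algebra.Group_Action"
begin

section \<open>Lie groups\<close>

text \<open>
  The model space is \<^const>\<open>Euclidean_space\<close> \<open>n\<close>, whose points are the sequences vanishing from
  index \<open>n\<close> on; so \<open>n\<close> is an arbitrary natural number and \<open>n = 0\<close> (discrete groups, hence all
  finite groups) is included.
\<close>

text \<open>\<open>C\<^sup>k\<close> functions on an open subset \<open>W\<close> of \<open>\<real>\<^sup>n\<close>: continuous, and all first partial derivatives
  exist and are \<open>C\<^sup>k\<^sup>-\<^sup>1\<close>.\<close>

primrec Ck_on :: "nat \<Rightarrow> nat \<Rightarrow> (nat \<Rightarrow> real) set \<Rightarrow> ((nat \<Rightarrow> real) \<Rightarrow> real) \<Rightarrow> bool" where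
  "Ck_on n 0 W f \<longleftrightarrow> continuous_map (subtopology (Euclidean_space n) W) euclideanreal f"
| "Ck_on n (Suc k) W f \<longleftrightarrow>
     continuous_map (subtopology (Euclidean_space n) W) euclideanreal f \<and>
     (\<exists>D. \<forall>i<n. (\<forall>x\<in>W. ((\<lambda>t. f (x(i := x i + t))) has_real_derivative D i x) (at 0)) \<and>
                Ck_on n k W (D i))"

definition smooth_on ::
    "nat \<Rightarrow> nat \<Rightarrow> (nat \<Rightarrow> real) set \<Rightarrow> ((nat \<Rightarrow> real) \<Rightarrow> (nat \<Rightarrow> real)) \<Rightarrow> bool" where
  "smooth_on n m W f \<longleftrightarrow> (\<forall>j<m. \<forall>k. Ck_on n k W (\<lambda>x. f x j))"

type_synonym 'a chart = "'a set \<times> ('a \<Rightarrow> nat \<Rightarrow> real)"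

definition is_chart :: "nat \<Rightarrow> 'a topology \<Rightarrow> 'a chart \<Rightarrow> bool" where
  "is_chart n X = (\<lambda>(U, \<phi>).
     openin X U \<and> openin (Euclidean_space n) (\<phi> ` U) \<and>
     homeomorphic_map (subtopology X U) (subtopology (Euclidean_space n) (\<phi> ` U)) \<phi>)"

definition smooth_atlas :: "nat \<Rightarrow> 'a topology \<Rightarrow> 'a chart set \<Rightarrow> bool" where
  "smooth_atlas n X \<A> \<longleftrightarrow>
     (\<forall>c\<in>\<A>. is_chart n X c) \<and> (\<Union>(U, \<phi>)\<in>\<A>. U) = topspace X \<and>
     (\<forall>(U, \<phi>)\<in>\<A>. \<forall>(V, \<psi>)\<in>\<A>. smooth_on n n (\<phi> ` (U \<inter> V)) (\<psi> \<circ> inv_into U \<phi>))"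

definition smooth_manifold :: "nat \<Rightarrow> 'a topology \<Rightarrow> 'a chart set \<Rightarrow> bool" where
  "smooth_manifold n X \<A> \<longleftrightarrow> Hausdorff_space X \<and> second_countable X \<and> smooth_atlas n X \<A>"

definition smooth_map :: "nat \<Rightarrow> 'a topology \<Rightarrow> 'a chart set \<Rightarrow>
    nat \<Rightarrow> 'b topology \<Rightarrow> 'b chart set \<Rightarrow> ('a \<Rightarrow> 'b) \<Rightarrow> bool" where
  "smooth_map n X \<A> m Y \<B> f \<longleftrightarrow> continuous_map X Y f \<and>
     (\<forall>(U, \<phi>)\<in>\<A>. \<forall>(V, \<psi>)\<in>\<B>. smooth_on n m (\<phi> ` {p \<in> U. f p \<in> V}) (\<psi> \<circ> f \<circ> inv_into U \<phi>))"

text \<open>The product atlas, with \<open>\<real>\<^sup>n \<times> \<real>\<^sup>m\<close> identified with \<open>\<real>\<^sup>n\<^sup>+\<^sup>m\<close>.\<close>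

definition prod_atlas :: "nat \<Rightarrow> 'a chart set \<Rightarrow> 'b chart set \<Rightarrow> ('a \<times> 'b) chart set" where
  "prod_atlas n \<A> \<B> =
     (\<lambda>((U, \<phi>), (V, \<psi>)). (U \<times> V, \<lambda>(p, q) i. if i < n then \<phi> p i else \<psi> q (i - n))) ` (\<A> \<times> \<B>)"

definition lie_group :: "('g, 'e) monoid_scheme \<Rightarrow> 'g topology \<Rightarrow> nat \<Rightarrow> 'g chart set \<Rightarrow> bool" where
  "lie_group G X n \<A> \<longleftrightarrow>
     Group.group G \<and> topspace X = carrier G \<and> smooth_manifold n X \<A> \<and>
     smooth_map (n + n) (prod_topology X X) (prod_atlas n \<A> \<A>) n X \<A> (\<lambda>(x, y). x \<otimes>\<^bsub>G\<^esub> y) \<and>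
     smooth_map n X \<A> n X \<A> (\<lambda>x. inv\<^bsub>G\<^esub> x)"

definition compact_lie_group ::
    "('g, 'e) monoid_scheme \<Rightarrow> 'g topology \<Rightarrow> nat \<Rightarrow> 'g chart set \<Rightarrow> bool" where
  "compact_lie_group G X n \<A> \<longleftrightarrow> lie_group G X n \<A> \<and> compact_space X"

definition orthogonal_action ::
    "('g, 'e) monoid_scheme \<Rightarrow> 'g topology \<Rightarrow> ('g \<Rightarrow> 'h::real_inner \<Rightarrow> 'h) \<Rightarrow> bool" where
  "orthogonal_action G X \<rho> \<longleftrightarrow>
     group_action G UNIV \<rho> \<and>
     (\<forall>g\<in>carrier G. orthogonal_transformation (\<rho> g)) \<and>
     continuous_map (prod_topology X euclidean) euclidean (\<lambda>(g, u). \<rho> g u)"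


section \<open>Operators on a Hilbert space\<close>

definition finite_dimensional :: "'a::real_vector set \<Rightarrow> bool" where
  "finite_dimensional V \<longleftrightarrow> (\<exists>B. finite B \<and> V = span B)"

definition blinfun_adjoint :: "('h::real_inner \<Rightarrow>\<^sub>L 'h) \<Rightarrow> ('h \<Rightarrow>\<^sub>L 'h)" where
  "blinfun_adjoint T = Blinfun (adjoint (blinfun_apply T))"

definition selfadjoint :: "('h::real_inner \<Rightarrow>\<^sub>L 'h) \<Rightarrow> bool" where
  "selfadjoint T \<longleftrightarrow> blinfun_adjoint T = T"

text \<open>The last conjunct says that the range has finite codimension.\<close>

definition fredholm :: "('h::real_normed_vector \<Rightarrow>\<^sub>L 'h) \<Rightarrow> bool" where
  "fredholm T \<longleftrightarrow>
     finite_dimensional {u. blinfun_apply T u = 0} \<and> closed (range (blinfun_apply T)) \<and>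
     (\<exists>B. finite B \<and> span (range (blinfun_apply T) \<union> B) = UNIV)"

definition essential_spectrum :: "('h::real_normed_vector \<Rightarrow>\<^sub>L 'h) \<Rightarrow> real set" where
  "essential_spectrum T = {\<mu>. \<not> fredholm (\<mu> *\<^sub>R id_blinfun - T)}"

definition FS :: "('h::real_inner \<Rightarrow>\<^sub>L 'h) set" where
  "FS = {T. selfadjoint T \<and> fredholm T}"

definition FS_plus :: "('h::real_inner \<Rightarrow>\<^sub>L 'h) set" where
  "FS_plus = {T \<in> FS. essential_spectrum T \<subseteq> {0<..}}"

definition FS_minus :: "('h::real_inner \<Rightarrow>\<^sub>L 'h) set" where
  "FS_minus = {T \<in> FS. essential_spectrum T \<subseteq> {..<0}}"

definition FS_i :: "('h::real_inner \<Rightarrow>\<^sub>L 'h) set" where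
  "FS_i = FS - (FS_plus \<union> FS_minus)"

definition compact_operator :: "('h::real_normed_vector \<Rightarrow>\<^sub>L 'h) \<Rightarrow> bool" where
  "compact_operator T \<longleftrightarrow> compact (closure (blinfun_apply T ` cball 0 1))"

definition KS :: "('h::real_inner \<Rightarrow>\<^sub>L 'h) set" where
  "KS = {T. selfadjoint T \<and> compact_operator T}"

definition GL :: "('h::real_normed_vector \<Rightarrow>\<^sub>L 'h) set" where
  "GL = {T. \<exists>S. T o\<^sub>L S = id_blinfun \<and> S o\<^sub>L T = id_blinfun}"

definition orthogonal_projection :: "('h::real_inner \<Rightarrow>\<^sub>L 'h) \<Rightarrow> bool" where
  "orthogonal_projection P \<longleftrightarrow> selfadjoint P \<and> P o\<^sub>L P = P"

definition is_symmetry :: "('h::real_inner \<Rightarrow>\<^sub>L 'h) \<Rightarrow> bool" where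
  "is_symmetry Q \<longleftrightarrow> (\<exists>P. orthogonal_projection P \<and>
     \<not> finite_dimensional {u. blinfun_apply P u = 0} \<and>
     \<not> finite_dimensional (range (blinfun_apply P)) \<and>
     Q = P - (id_blinfun - P))"

definition equivariant ::
    "('g, 'e) monoid_scheme \<Rightarrow> ('g \<Rightarrow> 'h::real_normed_vector \<Rightarrow> 'h) \<Rightarrow> ('h \<Rightarrow>\<^sub>L 'h) set" where
  "equivariant G \<rho> = {T. \<forall>g\<in>carrier G. \<forall>u. blinfun_apply T (\<rho> g u) = \<rho> g (blinfun_apply T u)}"

end

theory Submission
  imports Defs
begin

text \<open>
  An operator is equivariant iff it lies in the commutant of the set
  \<open>\<U>\<close> of operators by which the group acts, and \<open>\<U>\<close> is closed under adjoints because the action is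
  orthogonal. The commutant of such a set is a norm-closed algebra that is closed under adjoints and
  inverses and contains the orthogonal projection to the kernel of each of its selfadjoint elements.
  So it is enough to produce all operators from the given ones by these operations and by limits.

  \<^emph>\<open>Local step.\<close> Near a parameter \<open>s\<close>, let \<open>P\<close> be the projection to \<open>ker L\<^sub>s\<close>. As \<open>L\<^sub>s\<close> is selfadjoint and
  Fredholm, \<open>S = L\<^sub>s + P\<close> is invertible, and \<open>A\<^sub>t = S\<^sup>-\<^sup>1 (L\<^sub>t + P)\<close> is near the identity. Its square root
  \<open>N\<^sub>t\<close> depends continuously on \<open>t\<close> and inherits the relation \<open>S A\<^sub>t = A\<^sub>t\<^sup>* S\<close>. Therefore
  \<open>N\<^sub>t\<^sup>* S N\<^sub>t = S N\<^sub>t\<^sup>2 = L\<^sub>t + P\<close>, and \<open>M\<^sub>t = N\<^sub>t\<^sup>-\<^sup>1\<close> satisfies \<open>M\<^sub>t\<^sup>* L\<^sub>t M\<^sub>t = L\<^sub>s\<close> up to an operator of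
  finite rank (\<open>local_congruence_mod_finite_rank\<close>). The square root comes from the fixed-point equation
  \<open>Y = (X + Y\<^sup>2) / 2\<close>, whose solution lies in every closed subspace that contains \<open>X\<close> and is closed under
  squares (\<open>operator_square_root\<close>); this is how it inherits equivariance, symmetry and the relation
  with \<open>S\<close>.

  \<^emph>\<open>Global step.\<close> Two families on adjacent intervals with common end point \<open>b\<close> are joined by
  replacing the second one, \<open>M'\<^sub>t\<close>, by \<open>M'\<^sub>t M'\<^sub>b\<^sup>-\<^sup>1 M\<^sub>b\<close>. By compactness of the interval there is a
  path \<open>M\<close> such that all \<open>M\<^sub>t\<^sup>* L\<^sub>t M\<^sub>t\<close> agree up to finite rank (\<open>path_congruence_mod_finite_rank\<close>).

  \<^emph>\<open>Normalisation.\<close> At the parameter \<open>0\<close> the invertible operator \<open>S = L\<^sub>0 + P\<close> has a polar decomposition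
  \<open>S = Q \<bar>S\<bar>\<close>, again built from square roots, and \<open>\<bar>S\<bar>\<^sup>-\<^sup>1\<^sup>/\<^sup>2 S \<bar>S\<bar>\<^sup>-\<^sup>1\<^sup>/\<^sup>2 = Q\<close> is a selfadjoint involution
  (\<open>sign_congruence\<close>). If one of its eigenspaces were finite-dimensional, \<open>L\<^sub>0\<close> would be definite up
  to finite rank and its essential spectrum would lie on one side of \<open>0\<close>
  (\<open>sign_eigenspaces_infinite_dimensional\<close>); so \<open>Q\<close> is a symmetry. All the error terms have finite rank,
  hence are compact.

  The facts about Hilbert spaces on which this rests are the projection theorem, the Riesz
  representation, the Hellinger--Toeplitz theorem and the closedness of a sum of a closed and a
  finite-dimensional subspace.
\<close>

section \<open>Geometry of Hilbert spaces\<close>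

text \<open>By the parallelogram law, two points that are both almost nearest to \<open>x\<close> are close to each other as
  soon as their midpoint is at distance at least \<open>d\<close>.\<close>

lemma midpoint_norm_bound:
  fixes x u v :: "'h::real_inner"
  assumes d: "0 \<le> d" "d \<le> norm (x - (1/2) *\<^sub>R (u + v))"
    and u: "norm (x - u) ^ 2 \<le> d ^ 2 + e" and v: "norm (x - v) ^ 2 \<le> d ^ 2 + e"
  shows "norm (u - v) ^ 2 \<le> 4 * e"
proof -
  have "norm (u - v) ^ 2 + 4 * norm (x - (1/2) *\<^sub>R (u + v)) ^ 2
      = 2 * norm (x - u) ^ 2 + 2 * norm (x - v) ^ 2"
    unfolding power2_norm_eq_inner
    by (simp add: inner_simps inner_commute algebra_simps)
  moreover have "d ^ 2 \<le> norm (x - (1/2) *\<^sub>R (u + v)) ^ 2"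
    using d by (rule_tac power_mono)
  ultimately show ?thesis using u v by linarith
qed

text \<open>The completeness of the ambient space makes a minimising sequence for the distance to a closed
  subspace converge; the nearest point so obtained is the foot of the perpendicular.\<close>

lemma orthogonal_decomposition_closed_subspace:
  fixes V :: "'h::{real_inner,complete_space} set"
  assumes V: "subspace V" and cl: "closed V"
  shows "\<exists>v\<in>V. \<forall>w\<in>V. (x - v) \<bullet> w = 0"
proof -
  define d where "d = (INF v\<in>V. norm (x - v))"
  have ne: "V \<noteq> {}" using subspace_0[OF V] by auto
  have bdd: "bdd_below ((\<lambda>v. norm (x - v)) ` V)" by (rule bdd_belowI[of _ 0]) auto
  have d_le: "d \<le> norm (x - v)" if "v \<in> V" for v
    unfolding d_def using bdd that by (rule cINF_lower)
  have d0: "0 \<le> d" unfolding d_def using ne by (intro cINF_greatest) auto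
  have "\<exists>v\<in>V. norm (x - v) ^ 2 \<le> d ^ 2 + inverse (real (Suc n))" for n
  proof -
    have "d < sqrt (d ^ 2 + inverse (real (Suc n)))"
      by (rule real_less_rsqrt) simp
    then obtain v where v: "v \<in> V" "norm (x - v) < sqrt (d ^ 2 + inverse (real (Suc n)))"
      unfolding d_def using cINF_less_iff[OF ne bdd] by blast
    then have "norm (x - v) ^ 2 \<le> sqrt (d ^ 2 + inverse (real (Suc n))) ^ 2"
      by (intro power_mono) auto
    moreover have "0 \<le> d ^ 2 + inverse (real (Suc n))" by simp
    ultimately show ?thesis using v(1) by auto
  qed
  then obtain v where vV: "\<And>n. v n \<in> V"
      and v: "\<And>n. norm (x - v n) ^ 2 \<le> d ^ 2 + inverse (real (Suc n))" by metis
  have close: "norm (v m - v n) ^ 2 \<le> 4 * inverse (real (Suc N))" if "N \<le> m" "N \<le> n" for m n N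
  proof (rule midpoint_norm_bound[OF d0])
    show "d \<le> norm (x - (1/2) *\<^sub>R (v m + v n))"
      by (intro d_le subspace_scale[OF V] subspace_add[OF V] vV)
    have *: "norm (x - v k) ^ 2 \<le> d ^ 2 + inverse (real (Suc N))" if "N \<le> k" for k
      by (rule order_trans[OF v add_left_mono[OF le_imp_inverse_le]]) (use that in auto)
    show "norm (x - v m) ^ 2 \<le> d ^ 2 + inverse (real (Suc N))"
      and "norm (x - v n) ^ 2 \<le> d ^ 2 + inverse (real (Suc N))"
      using * that by blast+
  qed
  have "Cauchy v"
  proof (rule metric_CauchyI)
    fix e :: real assume e: "0 < e"
    obtain N where N: "inverse (real (Suc N)) < e ^ 2 / 4"
      using reals_Archimedean[of "e ^ 2 / 4"] e by auto
    have "dist (v m) (v n) < e" if "N \<le> m" "N \<le> n" for m n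
    proof -
      have "norm (v m - v n) ^ 2 < e ^ 2" using close[OF that] N by linarith
      then show ?thesis using e by (simp add: dist_norm power2_less_imp_less)
    qed
    then show "\<exists>M. \<forall>m\<ge>M. \<forall>n\<ge>M. dist (v m) (v n) < e" by blast
  qed
  then obtain w where w: "v \<longlonglongrightarrow> w" using Cauchy_convergent convergent_def by blast
  have wV: "w \<in> V" using cl vV w closed_sequentially by blast
  have "norm (x - w) ^ 2 \<le> d ^ 2"
  proof (rule LIMSEQ_le)
    show "(\<lambda>n. norm (x - v n) ^ 2) \<longlonglongrightarrow> norm (x - w) ^ 2" by (intro tendsto_intros w)
    show "(\<lambda>n. d ^ 2 + inverse (real (Suc n))) \<longlonglongrightarrow> d ^ 2"
      using tendsto_add[OF tendsto_const LIMSEQ_inverse_real_of_nat, of "d ^ 2"] by simp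
  qed (use v in auto)
  then have min: "norm (x - w) ^ 2 \<le> norm (x - u) ^ 2" if "u \<in> V" for u
    using power_mono[OF d_le[OF that] d0, of 2] by linarith
  have "(x - w) \<bullet> u = 0" if u: "u \<in> V" for u
  proof (cases "u = 0")
    case False
    \<comment> \<open>Move from \<open>w\<close> by the multiple of \<open>u\<close> that would decrease the distance most.\<close>
    define t where "t = ((x - w) \<bullet> u) / (u \<bullet> u)"
    have uu: "0 < u \<bullet> u" using False by simp
    have "norm (x - w) ^ 2 \<le> norm (x - (w + t *\<^sub>R u)) ^ 2"
      by (intro min subspace_add[OF V] subspace_scale[OF V] wV u)
    also have "\<dots> = norm (x - w) ^ 2 - 2 * t * ((x - w) \<bullet> u) + t ^ 2 * (u \<bullet> u)"
      unfolding power2_norm_eq_inner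
      by (simp add: inner_simps inner_commute power2_eq_square algebra_simps)
    also have "\<dots> = norm (x - w) ^ 2 - ((x - w) \<bullet> u) ^ 2 / (u \<bullet> u)"
      using uu unfolding t_def by (simp add: power2_eq_square field_simps)
    finally have "((x - w) \<bullet> u) ^ 2 / (u \<bullet> u) \<le> 0" by linarith
    then have "((x - w) \<bullet> u) ^ 2 \<le> 0" using uu by (simp add: divide_le_0_iff)
    then show ?thesis by simp
  qed simp
  then show ?thesis using wV by blast
qed

text \<open>The orthogonal complement of \<open>ker f\<close> is the line spanned by \<open>u = y - v\<close>, where \<open>f y \<noteq> 0\<close> and \<open>v\<close> is the
  projection of \<open>y\<close> to \<open>ker f\<close>; the representing vector is the multiple of \<open>u\<close> on which \<open>f\<close> takes the
  right value.\<close>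

theorem riesz_representation:
  fixes f :: "'h::{real_inner,complete_space} \<Rightarrow> real"
  assumes "bounded_linear f"
  shows "\<exists>z. \<forall>x. f x = x \<bullet> z"
proof (cases "\<exists>y. f y \<noteq> 0")
  case True
  then obtain y where y: "f y \<noteq> 0" by blast
  interpret f: bounded_linear f by fact
  have sub: "subspace {x. f x = 0}" by (auto simp: subspace_def f.add f.scale)
  have cl: "closed {x. f x = 0}"
    by (intro closed_Collect_eq continuous_intros f.continuous_on)
  obtain v where v: "f v = 0" and orth: "\<And>w. f w = 0 \<Longrightarrow> (y - v) \<bullet> w = 0"
    using orthogonal_decomposition_closed_subspace[OF sub cl, of y] by auto
  define u where "u = y - v"
  have fu: "f u \<noteq> 0" using y v by (simp add: u_def f.diff)
  then have uu: "u \<bullet> u \<noteq> 0" using f.zero by auto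
  have "f x = x \<bullet> ((f u / (u \<bullet> u)) *\<^sub>R u)" for x
  proof -
    have "u \<bullet> (x - (f x / f u) *\<^sub>R u) = 0"
      unfolding u_def by (rule orth, fold u_def) (use fu in \<open>simp add: f.diff f.scale\<close>)
    then have "u \<bullet> x = (f x / f u) * (u \<bullet> u)" by (simp add: inner_diff_right)
    then show ?thesis using fu uu by (simp add: inner_commute)
  qed
  then show ?thesis by blast
qed (auto intro!: exI[of _ 0])

section \<open>Adjoints\<close>

lemma blinfun_compose_assoc: "(S o\<^sub>L T) o\<^sub>L U = S o\<^sub>L (T o\<^sub>L U)"
  by (rule blinfun_eqI) simp

text \<open>The adjoint is a choice among the maps satisfying this identity, so it has content only once such a
  map is known to exist and to be bounded; existence is the Riesz representation of
  \<open>x \<mapsto> \<langle>T x, y\<rangle>\<close>.\<close>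

lemma blinfun_adjoint_inner:
  fixes T :: "'h::{real_inner,complete_space} \<Rightarrow>\<^sub>L 'h"
  shows "blinfun_apply T x \<bullet> y = x \<bullet> blinfun_apply (blinfun_adjoint T) y"
proof -
  have "\<exists>z. \<forall>x. blinfun_apply T x \<bullet> y = x \<bullet> z" for y
    by (intro riesz_representation bounded_linear_inner_left_comp blinfun.bounded_linear_right)
  then obtain g where g: "\<And>x y. blinfun_apply T x \<bullet> y = x \<bullet> g y" by metis
  have "norm (g y) \<le> norm y * norm T" for y
  proof -
    have "norm (g y) ^ 2 = blinfun_apply T (g y) \<bullet> y" using g by (simp add: power2_norm_eq_inner)
    also have "\<dots> \<le> norm T * norm (g y) * norm y"
      by (rule order_trans[OF norm_cauchy_schwarz mult_right_mono[OF norm_blinfun norm_ge_zero]])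
    finally have "norm (g y) * norm (g y) \<le> norm (g y) * (norm y * norm T)"
      by (simp add: power2_eq_square mult_ac)
    then show ?thesis by (cases "g y = 0") auto
  qed
  moreover have "g (a + b) = g a + g b" "g (r *\<^sub>R a) = r *\<^sub>R g a" for a b r
    by (rule vector_eq_ldot[THEN iffD1], simp add: g[symmetric] inner_simps)+
  ultimately have "bounded_linear g" by (intro bounded_linear_intro)
  moreover have "adjoint (blinfun_apply T) = g" by (rule adjoint_unique) (simp add: g)
  ultimately show ?thesis by (simp add: blinfun_adjoint_def bounded_linear_Blinfun_apply g)
qed

lemma blinfun_adjoint_unique:
  fixes T :: "'h::{real_inner,complete_space} \<Rightarrow>\<^sub>L 'h"
  assumes "\<And>x y. blinfun_apply T x \<bullet> y = x \<bullet> blinfun_apply S y"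
  shows "blinfun_adjoint T = S"
  by (rule blinfun_eqI, rule vector_eq_ldot[THEN iffD1])
    (simp add: assms blinfun_adjoint_inner[symmetric])

lemma selfadjoint_iff_symmetric:
  fixes T :: "'h::{real_inner,complete_space} \<Rightarrow>\<^sub>L 'h"
  shows "selfadjoint T \<longleftrightarrow> (\<forall>x y. blinfun_apply T x \<bullet> y = x \<bullet> blinfun_apply T y)"
  unfolding selfadjoint_def by (metis blinfun_adjoint_inner blinfun_adjoint_unique)

context
  fixes S T :: "'h::{real_inner,complete_space} \<Rightarrow>\<^sub>L 'h"
begin

lemma blinfun_adjoint_adjoint [simp]: "blinfun_adjoint (blinfun_adjoint T) = T"
  by (rule blinfun_adjoint_unique) (metis blinfun_adjoint_inner inner_commute)

lemma blinfun_adjoint_id [simp]: "blinfun_adjoint (id_blinfun :: 'h \<Rightarrow>\<^sub>L 'h) = id_blinfun"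
  by (rule blinfun_adjoint_unique) simp

lemma blinfun_adjoint_add: "blinfun_adjoint (S + T) = blinfun_adjoint S + blinfun_adjoint T"
  by (rule blinfun_adjoint_unique) (simp add: inner_simps blinfun_adjoint_inner blinfun.add_left)

lemma blinfun_adjoint_diff: "blinfun_adjoint (S - T) = blinfun_adjoint S - blinfun_adjoint T"
  by (rule blinfun_adjoint_unique) (simp add: inner_simps blinfun_adjoint_inner blinfun.diff_left)

lemma blinfun_adjoint_scaleR: "blinfun_adjoint (r *\<^sub>R T) = r *\<^sub>R blinfun_adjoint T"
  by (rule blinfun_adjoint_unique) (simp add: blinfun_adjoint_inner blinfun.scaleR_left)

lemma blinfun_adjoint_compose:
  "blinfun_adjoint (S o\<^sub>L T) = blinfun_adjoint T o\<^sub>L blinfun_adjoint S"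
  by (rule blinfun_adjoint_unique) (simp add: blinfun_adjoint_inner)

lemma norm_blinfun_adjoint_le: "norm (blinfun_adjoint T) \<le> norm T"
proof (rule norm_blinfun_bound)
  fix y
  let ?z = "blinfun_apply (blinfun_adjoint T) y"
  have "norm ?z ^ 2 = blinfun_apply T ?z \<bullet> y"
    by (simp add: power2_norm_eq_inner blinfun_adjoint_inner)
  also have "\<dots> \<le> norm T * norm ?z * norm y"
    by (rule order_trans[OF norm_cauchy_schwarz mult_right_mono[OF norm_blinfun norm_ge_zero]])
  finally have "norm ?z * norm ?z \<le> norm ?z * (norm T * norm y)"
    by (simp add: power2_eq_square mult_ac)
  then show "norm ?z \<le> norm T * norm y" by (cases "?z = 0") auto
qed simp

end

lemma bounded_linear_blinfun_adjoint:
  "bounded_linear (blinfun_adjoint :: ('h::{real_inner,complete_space} \<Rightarrow>\<^sub>L 'h) \<Rightarrow> _)"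
  by (rule bounded_linear_intro[where K = 1])
    (simp_all add: blinfun_adjoint_add blinfun_adjoint_scaleR norm_blinfun_adjoint_le)

lemma selfadjoint_congruence:
  fixes T M :: "'h::{real_inner,complete_space} \<Rightarrow>\<^sub>L 'h"
  assumes "selfadjoint T"
  shows "selfadjoint (blinfun_adjoint M o\<^sub>L T o\<^sub>L M)"
  using assms unfolding selfadjoint_def by (simp add: blinfun_adjoint_compose blinfun_compose_assoc)

section \<open>Inverses and square roots of operators near the identity\<close>

lemmas blinfun_compose_add_left = bounded_bilinear.add_left[OF bounded_bilinear_blinfun_compose]
  and blinfun_compose_add_right = bounded_bilinear.add_right[OF bounded_bilinear_blinfun_compose]
  and blinfun_compose_diff_left = bounded_bilinear.diff_left[OF bounded_bilinear_blinfun_compose]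
  and blinfun_compose_diff_right = bounded_bilinear.diff_right[OF bounded_bilinear_blinfun_compose]
  and blinfun_compose_scaleR_left = bounded_bilinear.scaleR_left[OF bounded_bilinear_blinfun_compose]
  and blinfun_compose_scaleR_right = bounded_bilinear.scaleR_right[OF bounded_bilinear_blinfun_compose]

lemmas blinfun_compose_bilinear = blinfun_compose_add_left blinfun_compose_add_right
  blinfun_compose_diff_left blinfun_compose_diff_right
  blinfun_compose_scaleR_left blinfun_compose_scaleR_right

lemma blinfun_compose_id [simp]: "id_blinfun o\<^sub>L T = T" "T o\<^sub>L id_blinfun = T"
  by (rule blinfun_eqI, simp)+

text \<open>A norm-Cauchy sequence of operators converges pointwise. Letting one index of the Cauchy estimate
  tend to infinity shows both that the pointwise limit is bounded and that it is a norm limit.\<close>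

lemma complete_UNIV_blinfun:
  "complete (UNIV :: ('a::real_normed_vector \<Rightarrow>\<^sub>L 'b::{real_normed_vector,complete_space}) set)"
proof (rule completeI)
  fix X :: "nat \<Rightarrow> 'a \<Rightarrow>\<^sub>L 'b" assume "Cauchy X"
  have step: "norm (blinfun_apply (X m) x - blinfun_apply (X n) x) \<le> norm (X m - X n) * norm x"
    for m n x using norm_blinfun[of "X m - X n" x] by (simp add: blinfun.diff_left)
  have "Cauchy (\<lambda>n. blinfun_apply (X n) x)" for x
  proof (rule metric_CauchyI)
    fix e :: real assume e: "0 < e"
    then have "0 < e / (norm x + 1)" by (simp add: add_nonneg_pos)
    then obtain N where N: "\<And>m n. N \<le> m \<Longrightarrow> N \<le> n \<Longrightarrow> norm (X m - X n) < e / (norm x + 1)"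
      using metric_CauchyD[OF \<open>Cauchy X\<close>] unfolding dist_norm by meson
    have "dist (blinfun_apply (X m) x) (blinfun_apply (X n) x) < e" if "N \<le> m" "N \<le> n" for m n
    proof -
      have "norm (X m - X n) * norm x \<le> norm (X m - X n) * (norm x + 1)"
        by (intro mult_left_mono) auto
      also have "\<dots> < e" using N[OF that] by (simp add: pos_less_divide_eq add_nonneg_pos)
      finally show ?thesis using step[of m x n] by (simp add: dist_norm)
    qed
    then show "\<exists>M. \<forall>m\<ge>M. \<forall>n\<ge>M. dist (blinfun_apply (X m) x) (blinfun_apply (X n) x) < e"
      by blast
  qed
  then have "\<exists>y. (\<lambda>n. blinfun_apply (X n) x) \<longlonglongrightarrow> y" for x
    using Cauchy_convergent convergent_def by blast
  then obtain v where v: "\<And>x. (\<lambda>n. blinfun_apply (X n) x) \<longlonglongrightarrow> v x" by metis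
  have close: "\<exists>N. \<forall>n\<ge>N. \<forall>x. norm (blinfun_apply (X n) x - v x) \<le> e * norm x" if e: "0 < e" for e
  proof -
    obtain N where N: "\<And>m n. N \<le> m \<Longrightarrow> N \<le> n \<Longrightarrow> norm (X m - X n) < e"
      using metric_CauchyD[OF \<open>Cauchy X\<close> e] unfolding dist_norm by meson
    have "norm (blinfun_apply (X n) x - v x) \<le> e * norm x" if "N \<le> n" for n x
    proof (rule tendsto_upperbound)
      show "(\<lambda>m. norm (blinfun_apply (X n) x - blinfun_apply (X m) x))
          \<longlonglongrightarrow> norm (blinfun_apply (X n) x - v x)"
        by (intro tendsto_intros v)
      have "norm (blinfun_apply (X n) x - blinfun_apply (X m) x) \<le> e * norm x" if "N \<le> m" for m
        by (rule order_trans[OF step mult_right_mono]) (use N[OF \<open>N \<le> n\<close> that] in auto)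
      then show "\<forall>\<^sub>F m in sequentially.
          norm (blinfun_apply (X n) x - blinfun_apply (X m) x) \<le> e * norm x"
        using eventually_at_top_linorder by blast
    qed simp
    then show ?thesis by blast
  qed
  obtain N where N: "\<And>x. norm (blinfun_apply (X N) x - v x) \<le> 1 * norm x"
    using close[of 1] by auto
  have "bounded_linear v"
  proof (rule bounded_linear_intro)
    show "v (x + y) = v x + v y" for x y
      using LIMSEQ_unique[OF v[of "x + y"]] tendsto_add[OF v[of x] v[of y]]
      by (simp add: blinfun.add_right)
    show "v (r *\<^sub>R x) = r *\<^sub>R v x" for r x
      using LIMSEQ_unique[OF v[of "r *\<^sub>R x"]] tendsto_scaleR[OF tendsto_const v[of x], of r]
      by (simp add: blinfun.scaleR_right)
    show "norm (v x) \<le> norm x * (norm (X N) + 1)" for x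
    proof -
      have "norm (v x) \<le> norm (blinfun_apply (X N) x) + norm (blinfun_apply (X N) x - v x)"
        by (metis norm_minus_commute norm_triangle_sub)
      then show ?thesis using norm_blinfun[of "X N" x] N[of x] by (simp add: algebra_simps)
    qed
  qed
  then have app: "blinfun_apply (Blinfun v) = v" by (rule bounded_linear_Blinfun_apply)
  have "X \<longlonglongrightarrow> Blinfun v"
  proof (rule metric_LIMSEQ_I)
    fix e :: real assume e: "0 < e"
    then obtain N where N: "\<forall>n\<ge>N. \<forall>x. norm (blinfun_apply (X n) x - v x) \<le> (e / 2) * norm x"
      using close[of "e / 2"] by auto
    have "norm (X n - Blinfun v) \<le> e / 2" if "N \<le> n" for n
      using N that e by (intro norm_blinfun_bound) (auto simp: blinfun.diff_left app)
    then show "\<exists>N. \<forall>n\<ge>N. dist (X n) (Blinfun v) < e"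
      using e by (intro exI[of _ N]) (force simp: dist_norm)
  qed
  then show "\<exists>T\<in>UNIV. X \<longlonglongrightarrow> T" by blast
qed

definition inverse_ops :: "('h::real_normed_vector \<Rightarrow>\<^sub>L 'h) \<Rightarrow> ('h \<Rightarrow>\<^sub>L 'h) \<Rightarrow> bool" where
  "inverse_ops S T \<longleftrightarrow> S o\<^sub>L T = id_blinfun \<and> T o\<^sub>L S = id_blinfun"

lemma inverse_opsD:
  assumes "inverse_ops S T"
  shows "S o\<^sub>L T = id_blinfun" "T o\<^sub>L S = id_blinfun"
    "blinfun_apply S (blinfun_apply T x) = x" "blinfun_apply T (blinfun_apply S x) = x"
    "S o\<^sub>L (T o\<^sub>L A) = A" "T o\<^sub>L (S o\<^sub>L A) = A"
proof -
  show *: "S o\<^sub>L T = id_blinfun" "T o\<^sub>L S = id_blinfun" using assms unfolding inverse_ops_def by auto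
  show "blinfun_apply S (blinfun_apply T x) = x" "blinfun_apply T (blinfun_apply S x) = x"
    using *[THEN arg_cong[where f = "\<lambda>T. blinfun_apply T x"]] by auto
  show "S o\<^sub>L (T o\<^sub>L A) = A" "T o\<^sub>L (S o\<^sub>L A) = A"
    by (simp_all add: blinfun_compose_assoc[symmetric] *)
qed

lemma inverse_ops_sym: "inverse_ops S T \<Longrightarrow> inverse_ops T S"
  by (auto simp: inverse_ops_def)

lemma inverse_ops_uminus: "inverse_ops S T \<Longrightarrow> inverse_ops (- S) (- T)"
  by (simp add: inverse_ops_def bounded_bilinear.minus_left[OF bounded_bilinear_blinfun_compose]
      bounded_bilinear.minus_right[OF bounded_bilinear_blinfun_compose])

lemma inverse_ops_adjoint:
  fixes S :: "'h::{real_inner,complete_space} \<Rightarrow>\<^sub>L 'h"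
  assumes "inverse_ops S T"
  shows "inverse_ops (blinfun_adjoint S) (blinfun_adjoint T)"
  unfolding inverse_ops_def by (simp add: blinfun_adjoint_compose[symmetric] inverse_opsD[OF assms])

lemma inverse_ops_compose:
  assumes "inverse_ops S T" "inverse_ops S' T'"
  shows "inverse_ops (S o\<^sub>L S') (T' o\<^sub>L T)"
  unfolding inverse_ops_def
  by (simp add: blinfun_compose_assoc assms[THEN inverse_opsD(1)] assms[THEN inverse_opsD(2)]
      assms[THEN inverse_opsD(5)] assms[THEN inverse_opsD(6)])

text \<open>A right and a left inverse are fixed points of the contractions \<open>Z \<mapsto> I + Y Z\<close> and \<open>Z \<mapsto> I + Z Y\<close>; they
  coincide by associativity.\<close>

lemma neumann_inverse:
  fixes Y :: "'h::{real_normed_vector,complete_space} \<Rightarrow>\<^sub>L 'h"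
  assumes Y: "norm Y \<le> r" and r: "r < 1"
  shows "\<exists>Z. inverse_ops (id_blinfun - Y) Z \<and> norm Z \<le> 1 / (1 - r)"
proof -
  have r0: "0 \<le> r" using Y norm_ge_zero order_trans by blast
  have "\<exists>!Z. Z \<in> UNIV \<and> id_blinfun + (Y o\<^sub>L Z) = Z"
  proof (rule Banach_fix[OF complete_UNIV_blinfun UNIV_not_empty r0 r subset_UNIV])
    fix A B :: "'h \<Rightarrow>\<^sub>L 'h"
    have "norm (Y o\<^sub>L (A - B)) \<le> r * norm (A - B)"
      by (rule order_trans[OF norm_blinfun_compose mult_right_mono[OF Y norm_ge_zero]])
    then show "dist (id_blinfun + (Y o\<^sub>L A)) (id_blinfun + (Y o\<^sub>L B)) \<le> r * dist A B"
      by (simp add: dist_norm blinfun_compose_diff_right)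
  qed
  then obtain Z where Z: "id_blinfun + (Y o\<^sub>L Z) = Z" by blast
  have "\<exists>!Z. Z \<in> UNIV \<and> id_blinfun + (Z o\<^sub>L Y) = Z"
  proof (rule Banach_fix[OF complete_UNIV_blinfun UNIV_not_empty r0 r subset_UNIV])
    fix A B :: "'h \<Rightarrow>\<^sub>L 'h"
    have "norm ((A - B) o\<^sub>L Y) \<le> r * norm (A - B)"
      using norm_blinfun_compose[of "A - B" Y] mult_left_mono[OF Y norm_ge_zero[of "A - B"]]
      by (simp add: mult.commute)
    then show "dist (id_blinfun + (A o\<^sub>L Y)) (id_blinfun + (B o\<^sub>L Y)) \<le> r * dist A B"
      by (simp add: dist_norm blinfun_compose_diff_left)
  qed
  then obtain Z' where Z': "id_blinfun + (Z' o\<^sub>L Y) = Z'" by blast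
  have 1: "(id_blinfun - Y) o\<^sub>L Z = id_blinfun"
    using Z by (simp add: blinfun_compose_bilinear algebra_simps)
  have 2: "Z' o\<^sub>L (id_blinfun - Y) = id_blinfun"
    using Z' by (simp add: blinfun_compose_bilinear algebra_simps)
  have "Z' = Z" using 1 2 by (metis blinfun_compose_assoc blinfun_compose_id)
  moreover have "norm Z \<le> 1 / (1 - r)"
  proof -
    have "norm Z \<le> norm (id_blinfun :: 'h \<Rightarrow>\<^sub>L 'h) + norm (Y o\<^sub>L Z)"
      by (subst Z[symmetric]) (rule norm_triangle_ineq)
    also have "\<dots> \<le> 1 + r * norm Z"
      by (intro add_mono norm_blinfun_id_le order_trans[OF norm_blinfun_compose mult_right_mono] Y) auto
    finally show ?thesis using r by (simp add: pos_le_divide_eq algebra_simps)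
  qed
  ultimately show ?thesis using 1 2 unfolding inverse_ops_def by blast
qed

text \<open>The resolvent identity turns a uniform bound on the inverses into a Lipschitz estimate.\<close>

lemma continuous_on_inverse_ops:
  fixes N M :: "'a::metric_space \<Rightarrow> 'h::real_normed_vector \<Rightarrow>\<^sub>L 'h"
  assumes N: "continuous_on A N"
    and inv: "\<And>t. t \<in> A \<Longrightarrow> inverse_ops (N t) (M t)" and M: "\<And>t. t \<in> A \<Longrightarrow> norm (M t) \<le> C"
  shows "continuous_on A M"
  unfolding continuous_on
proof
  fix s assume s: "s \<in> A"
  have C: "0 \<le> C" using M[OF s] norm_ge_zero order_trans by blast
  have est: "norm (M t - M s) \<le> C * C * norm (N t - N s)" if t: "t \<in> A" for t
  proof -
    have eq: "M t - M s = M t o\<^sub>L ((N s - N t) o\<^sub>L M s)"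
      by (simp add: blinfun_compose_bilinear inverse_opsD[OF inv[OF s]] inverse_opsD[OF inv[OF t]])
    have "norm (M t - M s) \<le> norm (M t) * (norm (N s - N t) * norm (M s))"
      unfolding eq
      by (rule order_trans[OF norm_blinfun_compose mult_left_mono[OF norm_blinfun_compose]]) simp
    also have "\<dots> \<le> C * (norm (N s - N t) * C)"
      by (intro mult_mono M s t mult_nonneg_nonneg C) auto
    finally show ?thesis by (simp add: norm_minus_commute mult_ac)
  qed
  have "(N \<longlongrightarrow> N s) (at s within A)" using N s by (simp add: continuous_on)
  then have "((\<lambda>t. C * C * norm (N t - N s)) \<longlongrightarrow> 0) (at s within A)"
    by (intro tendsto_mult_right_zero tendsto_norm_zero) (simp add: LIM_zero_iff)
  then have "((\<lambda>t. M t - M s) \<longlongrightarrow> 0) (at s within A)"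
    by (rule Lim_null_comparison[rotated]) (use est in \<open>simp add: eventually_at_filter\<close>)
  then show "(M \<longlongrightarrow> M s) (at s within A)" by (simp add: LIM_zero_iff)
qed

text \<open>The Lax--Milgram lemma: for small \<open>c > 0\<close> coercivity makes \<open>I - c T\<close> a strict contraction, so
  that \<open>c T\<close> is inverted by a Neumann series.\<close>

lemma coercive_invertible:
  fixes T :: "'h::{real_inner,complete_space} \<Rightarrow>\<^sub>L 'h"
  assumes d: "0 < d" and co: "\<And>x. d * norm x ^ 2 \<le> blinfun_apply T x \<bullet> x"
  shows "\<exists>Z. inverse_ops T Z"
proof -
  define K where "K = norm T ^ 2 + d ^ 2"
  have K: "0 < K" using d by (simp add: K_def add_nonneg_pos)
  define c where "c = d / K"
  have c: "0 < c" using d K by (simp add: c_def)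
  define r where "r = sqrt (1 - d ^ 2 / K)"
  have dK: "d ^ 2 / K \<le> 1" "0 < d ^ 2 / K" using K d by (auto simp: K_def)
  have r: "r < 1" "0 \<le> r" "r ^ 2 = 1 - d ^ 2 / K" using dK by (auto simp: r_def)
  have "norm (id_blinfun - c *\<^sub>R T) \<le> r"
  proof (rule norm_blinfun_bound[OF r(2)])
    fix x
    let ?y = "blinfun_apply T x"
    have "norm ?y ^ 2 \<le> (norm T * norm x) ^ 2" by (intro power_mono norm_blinfun) auto
    then have Ty: "c ^ 2 * norm ?y ^ 2 \<le> c ^ 2 * (norm T ^ 2 * norm x ^ 2)"
      by (intro mult_left_mono) (auto simp: power_mult_distrib)
    have "norm (x - c *\<^sub>R ?y) ^ 2 = norm x ^ 2 - 2 * c * (?y \<bullet> x) + c ^ 2 * norm ?y ^ 2"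
      unfolding power2_norm_eq_inner
      by (simp add: inner_diff inner_commute power2_eq_square algebra_simps)
    also have "\<dots> \<le> norm x ^ 2 - 2 * c * (d * norm x ^ 2) + c ^ 2 * (norm T ^ 2 * norm x ^ 2)"
      using Ty mult_left_mono[OF co[of x], of "2 * c"] c by linarith
    also have "\<dots> = (1 - 2 * c * d + c ^ 2 * norm T ^ 2) * norm x ^ 2" by (simp add: algebra_simps)
    also have "\<dots> \<le> (r * norm x) ^ 2"
    proof -
      have "c ^ 2 * norm T ^ 2 \<le> c ^ 2 * K" by (intro mult_left_mono) (auto simp: K_def)
      also have "\<dots> = c * d" using K by (simp add: c_def power2_eq_square)
      finally have "1 - 2 * c * d + c ^ 2 * norm T ^ 2 \<le> 1 - c * d" by linarith
      also have "\<dots> = r ^ 2" unfolding r(3) by (simp add: c_def power2_eq_square)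
      finally show ?thesis by (simp add: power_mult_distrib mult_right_mono)
    qed
    finally have "norm (x - c *\<^sub>R ?y) \<le> r * norm x"
      by (rule power2_le_imp_le) (use r(2) in simp)
    then show "norm (blinfun_apply (id_blinfun - c *\<^sub>R T) x) \<le> r * norm x"
      by (simp add: blinfun.diff_left blinfun.scaleR_left)
  qed
  then obtain Z where "inverse_ops (c *\<^sub>R T) Z"
    using neumann_inverse[OF _ r(1), of "id_blinfun - c *\<^sub>R T"] by auto
  then have "inverse_ops T (c *\<^sub>R Z)" by (simp add: inverse_ops_def blinfun_compose_bilinear)
  then show ?thesis by blast
qed

text \<open>Linear conditions such as \<open>S Y = Y\<^sup>* S\<close> or \<open>Y\<^sup>* = Y\<close> are not inherited by products, but they are
  inherited by squares. Since the square root below is a limit of iterated sums and squares, this is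
  the closure property that it needs.\<close>

definition closed_jordan :: "('h::real_normed_vector \<Rightarrow>\<^sub>L 'h) set \<Rightarrow> bool" where
  "closed_jordan J \<longleftrightarrow> closed J \<and> subspace J \<and> (\<forall>A\<in>J. A o\<^sub>L A \<in> J)"

lemma closed_jordan_UNIV: "closed_jordan UNIV"
  by (simp add: closed_jordan_def)

lemma closed_jordan_Int: "closed_jordan J \<Longrightarrow> closed_jordan J' \<Longrightarrow> closed_jordan (J \<inter> J')"
  by (auto simp: closed_jordan_def subspace_inter)

lemma norm_square_diff_le:
  assumes "norm A \<le> r" "norm B \<le> r"
  shows "norm ((A o\<^sub>L A) - (B o\<^sub>L B)) \<le> 2 * r * norm (A - B)"
proof -
  have "(A o\<^sub>L A) - (B o\<^sub>L B) = (A o\<^sub>L (A - B)) + ((A - B) o\<^sub>L B)"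
    by (simp add: blinfun_compose_bilinear)
  also have "norm \<dots> \<le> norm A * norm (A - B) + norm (A - B) * norm B"
    by (rule order_trans[OF norm_triangle_ineq]) (intro add_mono norm_blinfun_compose)
  also have "\<dots> \<le> r * norm (A - B) + norm (A - B) * r"
    using assms by (intro add_mono mult_right_mono mult_left_mono) auto
  finally show ?thesis by (simp add: mult_ac)
qed

text \<open>Writing the root of \<open>I - X\<close> as \<open>I - Y\<close> leads to \<open>Y = (X + Y\<^sup>2) / 2\<close>. For \<open>\<parallel>X\<parallel> \<le> q < 1\<close> the right-hand
  side contracts the ball whose radius solves the scalar equation \<open>r = (q + r\<^sup>2) / 2\<close>.\<close>

theorem operator_square_root:
  fixes q :: real
  assumes q: "0 \<le> q" "q < 1"
  shows "\<exists>f r. r < 1 \<and>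
    (\<forall>X :: 'h::{real_normed_vector,complete_space} \<Rightarrow>\<^sub>L 'h. norm X \<le> q \<longrightarrow> norm (f X) \<le> r \<and>
      (id_blinfun - f X) o\<^sub>L (id_blinfun - f X) = id_blinfun - X \<and>
      (\<forall>J. closed_jordan J \<longrightarrow> X \<in> J \<longrightarrow> f X \<in> J)) \<and>
    continuous_on (cball 0 q) f"
proof -
  define r where "r = 1 - sqrt (1 - q)"
  have r: "0 \<le> r" "r < 1" using q by (auto simp: r_def)
  have "(1 - r) ^ 2 = 1 - q" using q by (simp add: r_def)
  then have req: "q + r * r = 2 * r" by (simp add: power2_eq_square algebra_simps)
  let ?F = "\<lambda>X Y :: 'h \<Rightarrow>\<^sub>L 'h. (1/2) *\<^sub>R (X + (Y o\<^sub>L Y))"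
  have lip: "norm (?F X Y - ?F X' Y') \<le> norm (X - X') / 2 + r * norm (Y - Y')"
    if "norm Y \<le> r" "norm Y' \<le> r" for X X' Y Y'
  proof -
    have "?F X Y - ?F X' Y' = (1/2) *\<^sub>R ((X - X') + ((Y o\<^sub>L Y) - (Y' o\<^sub>L Y')))"
      by (simp add: algebra_simps)
    then have "norm (?F X Y - ?F X' Y') = norm ((X - X') + ((Y o\<^sub>L Y) - (Y' o\<^sub>L Y'))) / 2"
      by simp
    then show ?thesis
      using norm_triangle_ineq[of "X - X'" "(Y o\<^sub>L Y) - (Y' o\<^sub>L Y')"] norm_square_diff_le[OF that]
      by simp
  qed
  \<comment> \<open>Solving the equation inside each \<open>J\<close> separately, and comparing with the solution for \<open>J = UNIV\<close>,
    puts one and the same solution in all of them.\<close>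
  have fixpoint: "\<exists>!Y. Y \<in> J \<inter> cball 0 r \<and> ?F X Y = Y"
    if J: "closed_jordan J" and X: "X \<in> J" "norm X \<le> q" for J X
  proof (rule Banach_fix[OF _ _ r])
    show "complete (J \<inter> cball 0 r)"
      using complete_closed_subset[OF closed_Int[OF _ closed_cball] subset_UNIV complete_UNIV_blinfun]
        J by (auto simp: closed_jordan_def)
    have "0 \<in> J" using J by (simp add: closed_jordan_def subspace_0)
    then show "J \<inter> cball 0 r \<noteq> {}" using r by auto
    have "?F X Y \<in> J \<inter> cball 0 r" if Y: "Y \<in> J" "norm Y \<le> r" for Y
    proof
      show "?F X Y \<in> J"
        using J X Y by (auto simp: closed_jordan_def intro!: subspace_scale subspace_add)
      have "norm (Y o\<^sub>L Y) \<le> r * r"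
        by (rule order_trans[OF norm_blinfun_compose]) (intro mult_mono Y r norm_ge_zero)
      then have "norm (X + (Y o\<^sub>L Y)) \<le> 2 * r"
        using norm_triangle_ineq[of X "Y o\<^sub>L Y"] X req by linarith
      then show "?F X Y \<in> cball 0 r" by simp
    qed
    then show "?F X ` (J \<inter> cball 0 r) \<subseteq> J \<inter> cball 0 r" by auto
    show "dist (?F X Y) (?F X Y') \<le> r * dist Y Y'"
      if "Y \<in> J \<inter> cball 0 r" "Y' \<in> J \<inter> cball 0 r" for Y Y'
      using lip[of Y Y' X X] that by (simp add: dist_norm)
  qed
  define f where "f X = (THE Y. Y \<in> cball 0 r \<and> ?F X Y = Y)" for X
  have uniq: "\<exists>!Y. Y \<in> cball 0 r \<and> ?F X Y = Y" if "norm X \<le> q" for X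
    using fixpoint[OF closed_jordan_UNIV UNIV_I that] by simp
  have f: "norm (f X) \<le> r" "?F X (f X) = f X" if "norm X \<le> q" for X
    using theI'[OF uniq[OF that]] unfolding f_def by auto
  have fJ: "f X \<in> J" if X: "norm X \<le> q" and J: "closed_jordan J" "X \<in> J" for X J
  proof -
    obtain Y where Y: "Y \<in> J \<inter> cball 0 r" "?F X Y = Y" using fixpoint[OF J X] by blast
    then have "Y \<in> cball 0 r \<and> ?F X Y = Y" by blast
    then have "f X = Y" unfolding f_def by (rule the1_equality[OF uniq[OF X]])
    then show ?thesis using Y by blast
  qed
  have root: "(id_blinfun - f X) o\<^sub>L (id_blinfun - f X) = id_blinfun - X" if "norm X \<le> q" for X
  proof -
    have "X + (f X o\<^sub>L f X) = 2 *\<^sub>R ?F X (f X)" by (simp add: algebra_simps)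
    also have "\<dots> = f X + f X" unfolding f(2)[OF that] by (simp add: scaleR_2)
    finally show ?thesis by (simp add: blinfun_compose_bilinear algebra_simps)
  qed
  have "continuous_on (cball 0 q) f"
  proof (rule lipschitz_on_continuous_on[where L = "1 / (2 * (1 - r))"], rule lipschitz_onI)
    fix X X' :: "'h \<Rightarrow>\<^sub>L 'h" assume "X \<in> cball 0 q" "X' \<in> cball 0 q"
    then have n: "norm X \<le> q" "norm X' \<le> q" by auto
    have "norm (f X - f X') \<le> norm (X - X') / 2 + r * norm (f X - f X')"
      using lip[OF f(1)[OF n(1)] f(1)[OF n(2)], of X X'] unfolding f(2)[OF n(1)] f(2)[OF n(2)] .
    then show "dist (f X) (f X') \<le> 1 / (2 * (1 - r)) * dist X X'"
      using r by (simp add: dist_norm field_simps)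
  qed (use r in simp)
  then show ?thesis using r f(1) fJ root by blast
qed

section \<open>Finite-dimensional subspaces and finite-rank operators\<close>

lemma finite_dimensional_subspace:
  assumes "subspace V" "V \<subseteq> span B" "finite B"
  shows "finite_dimensional V"
proof -
  obtain C where C: "C \<subseteq> V" "independent C" "V \<subseteq> span C" by (rule maximal_independent_subset)
  have "finite C" using independent_span_bound[OF assms(3) C(2)] C(1) assms(2) by blast
  moreover have "V = span C" using C assms(1) by (simp add: span_minimal subset_antisym)
  ultimately show ?thesis unfolding finite_dimensional_def by blast
qed

text \<open>Replacing the added vector by its component orthogonal to \<open>W\<close> makes membership in the larger
  span a condition that is continuous in \<open>x\<close>. Where \<open>u = 0\<close> the quotient is \<open>0\<close> by convention, which
  is the value wanted.\<close>

lemma span_insert_orthogonal: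
  fixes W :: "'h::{real_inner,complete_space} set"
  assumes W: "subspace W" and cl: "closed W"
  shows "\<exists>u. (\<forall>w\<in>W. u \<bullet> w = 0) \<and>
    (\<forall>x. x \<in> span (insert b W) \<longleftrightarrow> x - ((x \<bullet> u) / (u \<bullet> u)) *\<^sub>R u \<in> W)"
proof -
  have spW: "span W = W" using W by simp
  obtain v where v: "v \<in> W" and orth: "\<And>w. w \<in> W \<Longrightarrow> (b - v) \<bullet> w = 0"
    using orthogonal_decomposition_closed_subspace[OF W cl] by blast
  define u where "u = b - v"
  have "x \<in> span (insert b W) \<longleftrightarrow> x - ((x \<bullet> u) / (u \<bullet> u)) *\<^sub>R u \<in> W" for x
  proof
    assume "x \<in> span (insert b W)"
    then obtain k where "x - k *\<^sub>R b \<in> W" by (auto simp: span_insert spW)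
    then have "(x - k *\<^sub>R b) + k *\<^sub>R v \<in> W" using W v by (intro subspace_add subspace_scale)
    then have w: "x - k *\<^sub>R u \<in> W" by (simp add: u_def algebra_simps)
    then have "u \<bullet> (x - k *\<^sub>R u) = 0" unfolding u_def by (rule orth)
    then have "x \<bullet> u = k * (u \<bullet> u)" by (simp add: inner_diff_right inner_commute)
    then show "x - ((x \<bullet> u) / (u \<bullet> u)) *\<^sub>R u \<in> W" using w by (cases "u = 0") auto
  next
    let ?s = "(x \<bullet> u) / (u \<bullet> u)"
    assume "x - ?s *\<^sub>R u \<in> W"
    then have "(x - ?s *\<^sub>R u) - ?s *\<^sub>R v \<in> W"
      by (rule subspace_diff[OF W _ subspace_scale[OF W v]])
    moreover have "(x - ?s *\<^sub>R u) - ?s *\<^sub>R v = x - ?s *\<^sub>R b"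
      by (simp only: u_def scaleR_diff_right) simp
    ultimately show "x \<in> span (insert b W)" by (auto simp: span_insert spW)
  qed
  then show ?thesis using orth unfolding u_def by blast
qed

lemma closed_span_Un_finite:
  fixes V :: "'h::{real_inner,complete_space} set"
  assumes V: "subspace V" "closed V" and B: "finite B"
  shows "closed (span (V \<union> B))"
  using B
proof (induction B)
  case empty
  then show ?case using V by (metis Un_empty_right span_eq_iff)
next
  case (insert b B)
  let ?W = "span (V \<union> B)"
  obtain u where u: "\<And>x. x \<in> span (insert b ?W) \<longleftrightarrow> x - ((x \<bullet> u) / (u \<bullet> u)) *\<^sub>R u \<in> ?W"
    using span_insert_orthogonal[OF subspace_span insert.IH] by blast
  have "closed ((\<lambda>x. x - ((x \<bullet> u) / (u \<bullet> u)) *\<^sub>R u) -` ?W)"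
    unfolding divide_inverse using insert.IH by (intro closed_vimage continuous_intros)
  moreover have "(\<lambda>x. x - ((x \<bullet> u) / (u \<bullet> u)) *\<^sub>R u) -` ?W = span (insert b ?W)"
    using u by blast
  moreover have "span (insert b ?W) = span (V \<union> insert b B)"
    by (simp add: span_insert span_span)
  ultimately show ?case by simp
qed

lemma closed_span_finite:
  fixes B :: "'h::{real_inner,complete_space} set"
  assumes "finite B"
  shows "closed (span B)"
  using closed_span_Un_finite[OF subspace_single_0 _ assms] by (simp add: span_insert_0)

text \<open>Orthogonal coordinates of a bounded vector are bounded, so that bounded sets in a finite-dimensional
  subspace lie in sums of finitely many compact segments.\<close>

lemma bounded_span_finite_subset_compact:
  fixes B :: "'h::{real_inner,complete_space} set"
  assumes "finite B"
  shows "\<exists>C. compact C \<and> span B \<inter> cball 0 R \<subseteq> C"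
  using assms
proof (induction B)
  case empty
  then show ?case by (intro exI[of _ "{0}"]) auto
next
  case (insert b B)
  obtain C where C: "compact C" "span B \<inter> cball 0 R \<subseteq> C" using insert.IH by blast
  obtain u where orth: "\<And>w. w \<in> span B \<Longrightarrow> u \<bullet> w = 0"
    and u: "\<And>x. x \<in> span (insert b (span B)) \<longleftrightarrow> x - ((x \<bullet> u) / (u \<bullet> u)) *\<^sub>R u \<in> span B"
    using span_insert_orthogonal[OF subspace_span closed_span_finite[OF insert.hyps(1)]] by blast
  let ?r = "R * norm u / (u \<bullet> u)"
  let ?K = "(\<lambda>s. s *\<^sub>R u) ` {- ?r..?r}"
  have "compact ?K" by (intro compact_continuous_image continuous_intros compact_Icc)
  then have "compact {x + y | x y. x \<in> ?K \<and> y \<in> C}" using C(1) by (rule compact_sums)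
  moreover have "span (insert b B) \<inter> cball 0 R \<subseteq> {x + y | x y. x \<in> ?K \<and> y \<in> C}"
  proof
    fix x assume x: "x \<in> span (insert b B) \<inter> cball 0 R"
    then have nx: "norm x \<le> R" by simp
    let ?s = "(x \<bullet> u) / (u \<bullet> u)"
    let ?w = "x - ?s *\<^sub>R u"
    have "x \<in> span (insert b (span B))" using x by (auto simp add: span_insert span_span)
    then have w: "?w \<in> span B" using u by blast
    have "\<bar>x \<bullet> u\<bar> \<le> R * norm u"
      by (rule order_trans[OF Cauchy_Schwarz_ineq2 mult_right_mono[OF nx norm_ge_zero]])
    then have "\<bar>?s\<bar> \<le> ?r" by (simp add: abs_divide divide_right_mono)
    then have "?s \<in> {- ?r..?r}" by (simp only: atLeastAtMost_iff) linarith
    then have "?s *\<^sub>R u \<in> ?K" by (rule imageI)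
    moreover have "norm ?w \<le> norm x"
    proof -
      have "norm x ^ 2 = norm (?s *\<^sub>R u + ?w) ^ 2" by simp
      also have "\<dots> = norm (?s *\<^sub>R u) ^ 2 + norm ?w ^ 2"
        by (rule norm_add_Pythagorean) (simp add: orthogonal_def orth[OF w])
      finally have "norm ?w ^ 2 \<le> norm x ^ 2"
        using zero_le_power2[of "norm (?s *\<^sub>R u)"] by linarith
      then show ?thesis by (rule power2_le_imp_le[OF _ norm_ge_zero])
    qed
    then have "?w \<in> C" using C(2) w nx by auto
    moreover have "x = ?s *\<^sub>R u + ?w" by simp
    ultimately show "x \<in> {x + y | x y. x \<in> ?K \<and> y \<in> C}" by blast
  qed
  ultimately show ?case by blast
qed

definition finite_rank :: "('h::real_normed_vector \<Rightarrow>\<^sub>L 'h) \<Rightarrow> bool" where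
  "finite_rank T \<longleftrightarrow> finite_dimensional (range (blinfun_apply T))"

lemma subspace_range_blinfun: "subspace (range (blinfun_apply T))"
  by (intro linear_subspace_image subspace_UNIV bounded_linear.linear blinfun.bounded_linear_right)

lemma span_blinfun_image: "span (blinfun_apply T ` B) = blinfun_apply T ` span B"
  by (intro linear_span_image bounded_linear.linear blinfun.bounded_linear_right)

lemma finite_rankI:
  assumes "finite B" "\<And>x. blinfun_apply T x \<in> span B"
  shows "finite_rank T"
  unfolding finite_rank_def
  using assms by (intro finite_dimensional_subspace subspace_range_blinfun) auto

lemma finite_rankE:
  assumes "finite_rank T"
  obtains B where "finite B" "range (blinfun_apply T) = span B"
  using assms unfolding finite_rank_def finite_dimensional_def by blast

lemma finite_rank_add:
  assumes "finite_rank S" "finite_rank T"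
  shows "finite_rank (S + T)"
proof -
  obtain B where B: "finite B" "range (blinfun_apply S) = span B" using assms(1) by (rule finite_rankE)
  obtain C where C: "finite C" "range (blinfun_apply T) = span C" using assms(2) by (rule finite_rankE)
  show ?thesis
  proof (rule finite_rankI)
    show "finite (B \<union> C)" using B C by simp
    have "blinfun_apply S x \<in> span (B \<union> C)" "blinfun_apply T x \<in> span (B \<union> C)" for x
      using B(2) C(2) span_mono[of B "B \<union> C"] span_mono[of C "B \<union> C"] by auto
    then show "blinfun_apply (S + T) x \<in> span (B \<union> C)" for x
      by (simp add: blinfun.add_left span_add)
  qed
qed

lemma finite_rank_compose_right: "finite_rank S \<Longrightarrow> finite_rank (S o\<^sub>L T)"
  by (erule finite_rankE, erule finite_rankI) auto

lemma finite_rank_compose_left: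
  assumes "finite_rank T"
  shows "finite_rank (S o\<^sub>L T)"
proof -
  obtain B where B: "finite B" "range (blinfun_apply T) = span B" using assms by (rule finite_rankE)
  then show ?thesis
    by (intro finite_rankI[of "blinfun_apply S ` B"]) (auto simp: span_blinfun_image)
qed

lemma finite_rank_scaleR: "finite_rank T \<Longrightarrow> finite_rank (r *\<^sub>R T)"
  using finite_rank_compose_left[of T "r *\<^sub>R id_blinfun"] by (simp add: blinfun_compose_bilinear)

lemma finite_rank_diff: "finite_rank S \<Longrightarrow> finite_rank T \<Longrightarrow> finite_rank (S - T)"
  using finite_rank_add[of S "(-1) *\<^sub>R T"] finite_rank_scaleR[of T "-1"] by simp

lemma finite_rank_imp_compact_operator:
  fixes T :: "'h::{real_inner,complete_space} \<Rightarrow>\<^sub>L 'h"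
  assumes "finite_rank T"
  shows "compact_operator T"
proof -
  obtain B where B: "finite B" "range (blinfun_apply T) = span B" using assms by (rule finite_rankE)
  obtain C where C: "compact C" "span B \<inter> cball 0 (norm T) \<subseteq> C"
    using bounded_span_finite_subset_compact[OF B(1)] by blast
  have "blinfun_apply T x \<in> C" if "norm x \<le> 1" for x
  proof -
    have "norm (blinfun_apply T x) \<le> norm T"
      using order_trans[OF norm_blinfun mult_left_mono[OF that norm_ge_zero]] by simp
    moreover have "blinfun_apply T x \<in> span B" using B(2) by blast
    ultimately show ?thesis using C(2) by auto
  qed
  then have "closure (blinfun_apply T ` cball 0 1) \<subseteq> C"
    by (intro closure_minimal compact_imp_closed C(1)) auto
  then show ?thesis
    unfolding compact_operator_def by (metis C(1) closed_closure compact_Int_closed inf.absorb_iff2)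
qed

section \<open>Selfadjoint Fredholm operators\<close>

text \<open>Off a finite-dimensional complement of \<open>ker F\<close> the operator \<open>U - F\<close> agrees with the homeomorphism
  \<open>U\<close>, so its range is a closed subspace enlarged by finitely many vectors.\<close>

lemma fredholm_invertible_diff_finite_rank:
  fixes U F :: "'h::{real_inner,complete_space} \<Rightarrow>\<^sub>L 'h"
  assumes U: "inverse_ops U Z" and F: "finite_rank F"
  shows "fredholm (U - F)"
proof -
  let ?T = "U - F"
  obtain C where C: "finite C" "range (blinfun_apply F) = span C" using F by (rule finite_rankE)
  have Z: "blinfun_apply U (blinfun_apply Z x) = x" "blinfun_apply Z (blinfun_apply U x) = x" for x
    using inverse_opsD[OF U] by auto
  have lin: "linear (blinfun_apply T)" for T :: "'h \<Rightarrow>\<^sub>L 'h"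
    by (intro bounded_linear.linear blinfun.bounded_linear_right)
  have "finite_dimensional {x. blinfun_apply ?T x = 0}"
  proof (rule finite_dimensional_subspace)
    show "subspace {x. blinfun_apply ?T x = 0}" by (rule linear_subspace_kernel[OF lin])
    show "{x. blinfun_apply ?T x = 0} \<subseteq> span (blinfun_apply Z ` C)"
    proof
      fix x assume "x \<in> {x. blinfun_apply ?T x = 0}"
      then have "blinfun_apply U x = blinfun_apply F x" by (simp add: blinfun.diff_left)
      then have "x = blinfun_apply Z (blinfun_apply F x)" by (metis Z(2))
      then show "x \<in> span (blinfun_apply Z ` C)" using C(2) by (auto simp: span_blinfun_image)
    qed
  qed (use C in simp)
  moreover have "closed (range (blinfun_apply ?T))"
  proof -
    let ?K = "{x. blinfun_apply F x = 0}"
    have "C \<subseteq> range (blinfun_apply F)" using C(2) span_superset by simp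
    then obtain B where B: "finite B" "blinfun_apply F ` B = C"
      using C(1) by (metis finite_subset_image)
    have "x \<in> span (?K \<union> B)" for x
    proof -
      have "blinfun_apply F x \<in> blinfun_apply F ` span B"
        unfolding span_blinfun_image[symmetric] B(2) using C(2) by blast
      then obtain b where b: "b \<in> span B" "blinfun_apply F x = blinfun_apply F b" by blast
      then have "x - b \<in> ?K" by (simp add: blinfun.diff_right)
      then have "(x - b) + b \<in> span (?K \<union> B)"
        using b(1) span_mono[of B "?K \<union> B"] by (intro span_add) (auto intro: span_base)
      then show ?thesis by simp
    qed
    then have "range (blinfun_apply ?T) = blinfun_apply ?T ` span (?K \<union> B)" by auto
    also have "\<dots> = span (blinfun_apply ?T ` ?K \<union> blinfun_apply ?T ` B)"
      by (simp add: span_blinfun_image[symmetric] image_Un)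
    also have "blinfun_apply ?T ` ?K = {y. blinfun_apply (F o\<^sub>L Z) y = 0}"
    proof (intro subset_antisym subsetI)
      fix y assume "y \<in> blinfun_apply ?T ` ?K"
      then obtain x where "blinfun_apply F x = 0" "y = blinfun_apply U x" by (auto simp: blinfun.diff_left)
      then show "y \<in> {y. blinfun_apply (F o\<^sub>L Z) y = 0}" by (simp add: Z)
    next
      fix y assume "y \<in> {y. blinfun_apply (F o\<^sub>L Z) y = 0}"
      then show "y \<in> blinfun_apply ?T ` ?K"
        by (intro image_eqI[of _ _ "blinfun_apply Z y"]) (auto simp: blinfun.diff_left Z)
    qed
    finally have range: "range (blinfun_apply ?T)
        = span ({y. blinfun_apply (F o\<^sub>L Z) y = 0} \<union> blinfun_apply ?T ` B)" .
    have "closed {y. blinfun_apply (F o\<^sub>L Z) y = 0}"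
      by (intro closed_Collect_eq continuous_intros)
    then show ?thesis
      unfolding range using B(1) by (intro closed_span_Un_finite linear_subspace_kernel[OF lin]) auto
  qed
  moreover have "span (range (blinfun_apply ?T) \<union> C) = UNIV"
  proof (intro subset_antisym subsetI UNIV_I)
    fix y
    have "y = blinfun_apply ?T (blinfun_apply Z y) + blinfun_apply F (blinfun_apply Z y)"
      by (simp add: blinfun.diff_left Z)
    moreover have "blinfun_apply F (blinfun_apply Z y) \<in> span (range (blinfun_apply ?T) \<union> C)"
      using C(2) span_mono[of C "range (blinfun_apply ?T) \<union> C"] by blast
    ultimately show "y \<in> span (range (blinfun_apply ?T) \<union> C)"
      by (metis UnI1 rangeI span_add span_base)
  qed
  ultimately show ?thesis unfolding fredholm_def using C(1) by blast
qed

lemma fredholm_invertible: "inverse_ops U Z \<Longrightarrow> fredholm U"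
  for U :: "'h::{real_inner,complete_space} \<Rightarrow>\<^sub>L 'h"
  using fredholm_invertible_diff_finite_rank[of U Z 0] finite_rankI[of "{}" 0] by simp

text \<open>The foot of the perpendicular is unique, which makes it depend linearly on \<open>x\<close>.\<close>

lemma orthogonal_projection_exists:
  fixes V :: "'h::{real_inner,complete_space} set"
  assumes V: "subspace V" "closed V"
  shows "\<exists>P. selfadjoint P \<and> range (blinfun_apply P) = V \<and> (\<forall>x\<in>V. blinfun_apply P x = x)"
proof -
  obtain p where pV: "\<And>x. p x \<in> V" and orth: "\<And>x w. w \<in> V \<Longrightarrow> (x - p x) \<bullet> w = 0"
    using orthogonal_decomposition_closed_subspace[OF V] by metis
  have unique: "p x = v" if "v \<in> V" "\<And>w. w \<in> V \<Longrightarrow> (x - v) \<bullet> w = 0" for x v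
  proof -
    have d: "p x - v \<in> V" using V(1) pV that(1) by (rule subspace_diff)
    have "(p x - v) \<bullet> (p x - v) = (x - v) \<bullet> (p x - v) - (x - p x) \<bullet> (p x - v)"
      by (simp add: inner_diff)
    then show ?thesis using orth[OF d] that(2)[OF d] by simp
  qed
  have "bounded_linear p"
  proof (rule bounded_linear_intro)
    show "p (x + y) = p x + p y" for x y
    proof (rule unique)
      show "p x + p y \<in> V" using V(1) pV by (intro subspace_add)
      show "(x + y - (p x + p y)) \<bullet> w = 0" if "w \<in> V" for w
        using orth[OF that, of x] orth[OF that, of y] by (simp add: inner_diff_left inner_add_left)
    qed
    show "p (r *\<^sub>R x) = r *\<^sub>R p x" for r x
    proof (rule unique)
      show "r *\<^sub>R p x \<in> V" using V(1) pV by (intro subspace_scale)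
      show "(r *\<^sub>R x - r *\<^sub>R p x) \<bullet> w = 0" if "w \<in> V" for w
        using orth[OF that, of x] by (simp add: scaleR_diff_right[symmetric])
    qed
    show "norm (p x) \<le> norm x * 1" for x
    proof -
      have "norm x ^ 2 = norm ((x - p x) + p x) ^ 2" by simp
      also have "\<dots> = norm (x - p x) ^ 2 + norm (p x) ^ 2"
        by (rule norm_add_Pythagorean) (simp add: orthogonal_def orth[OF pV])
      finally have "norm (p x) ^ 2 \<le> norm x ^ 2"
        using zero_le_power2[of "norm (x - p x)"] by linarith
      then have "norm (p x) \<le> norm x" by (rule power2_le_imp_le[OF _ norm_ge_zero])
      then show ?thesis by simp
    qed
  qed
  then have app: "blinfun_apply (Blinfun p) = p" by (rule bounded_linear_Blinfun_apply)
  have fix_V: "p x = x" if "x \<in> V" for x using unique[OF that] by simp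
  have "p x \<bullet> y = x \<bullet> p y" for x y
  proof -
    have "p x \<bullet> y = p x \<bullet> p y" using orth[OF pV, of y x] by (simp add: inner_diff_left inner_commute[of "p x"])
    also have "\<dots> = x \<bullet> p y" using orth[OF pV, of x y] by (simp add: inner_diff_left)
    finally show ?thesis .
  qed
  then have "selfadjoint (Blinfun p)" by (simp add: selfadjoint_iff_symmetric app)
  moreover have "range p = V" using pV fix_V by (metis rangeI subset_antisym subsetI imageE)
  ultimately show ?thesis using fix_V app by metis
qed

text \<open>The Hellinger--Toeplitz theorem. By symmetry \<open>\<parallel>f x\<parallel> \<le> k\<close> is the conjunction over unit vectors \<open>u\<close>
  of the closed conditions \<open>\<bar>\<langle>x, f u\<rangle>\<bar> \<le> k\<close>; by Baire one of these closed sets contains a ball.\<close>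

theorem symmetric_imp_bounded_linear:
  fixes f :: "'h::{real_inner,complete_space} \<Rightarrow> 'h"
  assumes sym: "\<And>x y. f x \<bullet> y = x \<bullet> f y"
  shows "bounded_linear f"
proof -
  have add: "f (a + b) = f a + f b" and scale: "f (r *\<^sub>R a) = r *\<^sub>R f a" for a b r
    by (rule vector_eq_ldot[THEN iffD1], simp add: sym[symmetric] inner_simps)+
  define E where "E k = {x. norm (f x) \<le> real k}" for k
  have E: "E k = (\<Inter>u\<in>cball 0 1. {x. x \<bullet> f u \<le> real k})" for k
  proof (intro subset_antisym subsetI)
    fix x assume x: "x \<in> E k"
    have "x \<bullet> f u \<le> real k" if "norm u \<le> 1" for u
    proof -
      have "x \<bullet> f u \<le> norm (f x) * norm u" using norm_cauchy_schwarz[of "f x" u] by (simp add: sym)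
      also have "\<dots> \<le> real k * 1" using x that by (intro mult_mono) (auto simp: E_def)
      finally show ?thesis by simp
    qed
    then show "x \<in> (\<Inter>u\<in>cball 0 1. {x. x \<bullet> f u \<le> real k})" by simp
  next
    fix x assume x: "x \<in> (\<Inter>u\<in>cball 0 1. {x. x \<bullet> f u \<le> real k})"
    have "norm (sgn (f x)) \<le> 1" by (simp add: norm_sgn)
    then have "x \<bullet> f (sgn (f x)) \<le> real k" using x by auto
    moreover have "x \<bullet> f (sgn (f x)) = norm (f x)"
      by (cases "f x = 0")
        (simp_all add: sym[symmetric] sgn_div_norm power2_norm_eq_inner[symmetric] power2_eq_square)
    ultimately show "x \<in> E k" by (simp add: E_def)
  qed
  have "closed (E k)" for k
    unfolding E by (intro closed_INT ballI closed_Collect_le continuous_intros)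
  moreover have "(\<Union>k. E k) = UNIV" by (auto simp: E_def intro: real_arch_simple)
  moreover have "Met_TC.mcomplete TYPE('h)"
    unfolding Met_TC.mcomplete_def using Cauchy_convergent convergent_def by auto
  ultimately have "\<not> (\<forall>T\<in>range E. closed T \<and> interior T = {})"
    using Met_TC.metric_Baire_category_alt[of "range E"] by auto
  then have "\<exists>k. interior (E k) \<noteq> {}" using \<open>\<And>k. closed (E k)\<close> by blast
  then obtain k a where "a \<in> interior (E k)" by blast
  then obtain e where e: "0 < e" "cball a e \<subseteq> E k" unfolding mem_interior_cball by blast
  have "norm (f x) \<le> norm x * (2 * real k / e)" for x
  proof (cases "x = 0")
    case True
    then show ?thesis using scale[of 0 0] by simp
  next
    case False
    \<comment> \<open>Rescaled to length \<open>e\<close>, the vector is a difference of two points of the ball about \<open>a\<close>.\<close>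
    define z where "z = (e / norm x) *\<^sub>R x"
    have "a + z \<in> E k" "a \<in> E k" using e False by (auto simp: z_def dist_norm)
    then have "norm (f (a + z) - f a) \<le> 2 * real k"
      using norm_triangle_ineq4[of "f (a + z)" "f a"] by (simp add: E_def)
    then have "e / norm x * norm (f x) \<le> 2 * real k"
      using e by (simp add: add z_def scale)
    then show ?thesis using False e by (simp add: field_simps)
  qed
  then show ?thesis by (intro bounded_linear_intro[of f] add scale)
qed

text \<open>A vector in the kernel is orthogonal to the range, hence zero. The algebraic inverse is symmetric,
  and Hellinger--Toeplitz makes it bounded.\<close>

lemma selfadjoint_surjective_invertible:
  fixes S :: "'h::{real_inner,complete_space} \<Rightarrow>\<^sub>L 'h"
  assumes S: "selfadjoint S" and surj: "surj (blinfun_apply S)"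
  shows "\<exists>Z. inverse_ops S Z"
proof -
  have sym: "blinfun_apply S x \<bullet> y = x \<bullet> blinfun_apply S y" for x y
    using S by (simp add: selfadjoint_iff_symmetric)
  have inj: "x = y" if "blinfun_apply S x = blinfun_apply S y" for x y
  proof -
    have "x \<bullet> blinfun_apply S z = y \<bullet> blinfun_apply S z" for z using that by (simp add: sym[symmetric])
    then show ?thesis using surj by (metis surjD vector_eq_rdot)
  qed
  obtain g where g: "\<And>y. blinfun_apply S (g y) = y" using surj by (metis surjD)
  have gS: "g (blinfun_apply S x) = x" for x by (rule inj) (simp add: g)
  have "g x \<bullet> y = x \<bullet> g y" for x y using sym[of "g x" "g y"] by (simp add: g)
  then have "blinfun_apply (Blinfun g) = g"
    by (intro bounded_linear_Blinfun_apply symmetric_imp_bounded_linear)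
  then have "inverse_ops S (Blinfun g)"
    unfolding inverse_ops_def by (auto intro!: blinfun_eqI simp: g gS)
  then show ?thesis by blast
qed

text \<open>The range of a selfadjoint Fredholm operator is closed with orthogonal complement the kernel,
  and on the kernel the projection supplies what is missing.\<close>

lemma selfadjoint_fredholm_plus_kernel_projection_invertible:
  fixes L P :: "'h::{real_inner,complete_space} \<Rightarrow>\<^sub>L 'h"
  assumes L: "selfadjoint L" "fredholm L" and P: "selfadjoint P"
    "range (blinfun_apply P) = {x. blinfun_apply L x = 0}"
    "\<And>x. blinfun_apply L x = 0 \<Longrightarrow> blinfun_apply P x = x"
  shows "\<exists>Z. inverse_ops (L + P) Z"
proof (rule selfadjoint_surjective_invertible)
  show "selfadjoint (L + P)" using L(1) P(1) by (simp add: selfadjoint_def blinfun_adjoint_add)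
  have sym: "blinfun_apply L x \<bullet> y = x \<bullet> blinfun_apply L y" for x y
    using L by (simp add: selfadjoint_iff_symmetric)
  have "closed (range (blinfun_apply L))" using L(2) by (simp add: fredholm_def)
  then have decomp: "\<exists>v\<in>range (blinfun_apply L). \<forall>w\<in>range (blinfun_apply L). (y - v) \<bullet> w = 0" for y
    by (intro orthogonal_decomposition_closed_subspace subspace_range_blinfun)
  have "y \<in> range (blinfun_apply (L + P))" for y
  proof -
    \<comment> \<open>Split \<open>y\<close> into a vector in the range of \<open>L\<close> and a vector \<open>n\<close> orthogonal to it, which lies in
      the kernel by symmetry.\<close>
    obtain x where x: "\<And>z. (y - blinfun_apply L x) \<bullet> blinfun_apply L z = 0" using decomp[of y] by auto
    define n where "n = y - blinfun_apply L x"
    have "blinfun_apply L n \<bullet> z = 0" for z using x[of z] by (simp add: sym n_def)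
    then have n: "blinfun_apply L n = 0" by (metis inner_eq_zero_iff)
    have LP: "blinfun_apply L (blinfun_apply P z) = 0" for z using P(2) by blast
    have "blinfun_apply (L + P) (x - blinfun_apply P x + n) = blinfun_apply L x + n"
      using n by (simp add: blinfun.bilinear_simps LP P(3))
    then show ?thesis by (intro image_eqI[of _ _ "x - blinfun_apply P x + n"]) (auto simp: n_def)
  qed
  then show "surj (blinfun_apply (L + P))" by blast
qed

section \<open>Commutants\<close>

definition commutant :: "('h::real_normed_vector \<Rightarrow>\<^sub>L 'h) set \<Rightarrow> ('h \<Rightarrow>\<^sub>L 'h) set" where
  "commutant \<U> = {T. \<forall>W\<in>\<U>. T o\<^sub>L W = W o\<^sub>L T}"

definition adjoint_closed :: "('h::real_inner \<Rightarrow>\<^sub>L 'h) set \<Rightarrow> bool" where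
  "adjoint_closed \<U> \<longleftrightarrow> (\<forall>W\<in>\<U>. blinfun_adjoint W \<in> \<U>)"

lemma commutantD: "T \<in> commutant \<U> \<Longrightarrow> W \<in> \<U> \<Longrightarrow> T o\<^sub>L W = W o\<^sub>L T"
  by (simp add: commutant_def)

lemma commutant_id: "id_blinfun \<in> commutant \<U>"
  by (simp add: commutant_def)

lemma commutant_add: "S \<in> commutant \<U> \<Longrightarrow> T \<in> commutant \<U> \<Longrightarrow> S + T \<in> commutant \<U>"
  by (simp add: commutant_def blinfun_compose_bilinear)

lemma commutant_diff: "S \<in> commutant \<U> \<Longrightarrow> T \<in> commutant \<U> \<Longrightarrow> S - T \<in> commutant \<U>"
  by (simp add: commutant_def blinfun_compose_bilinear)

lemma commutant_scaleR: "T \<in> commutant \<U> \<Longrightarrow> r *\<^sub>R T \<in> commutant \<U>"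
  by (simp add: commutant_def blinfun_compose_bilinear)

lemma commutant_compose:
  assumes "S \<in> commutant \<U>" "T \<in> commutant \<U>"
  shows "S o\<^sub>L T \<in> commutant \<U>"
  unfolding commutant_def
proof (intro CollectI ballI)
  fix W assume W: "W \<in> \<U>"
  have "(S o\<^sub>L T) o\<^sub>L W = S o\<^sub>L (W o\<^sub>L T)"
    by (simp add: blinfun_compose_assoc commutantD[OF assms(2) W])
  also have "\<dots> = (W o\<^sub>L S) o\<^sub>L T"
    by (simp add: blinfun_compose_assoc[symmetric] commutantD[OF assms(1) W])
  finally show "(S o\<^sub>L T) o\<^sub>L W = W o\<^sub>L (S o\<^sub>L T)" by (simp add: blinfun_compose_assoc)
qed

lemma commutant_inverse:
  assumes S: "S \<in> commutant \<U>" and inv: "inverse_ops S T"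
  shows "T \<in> commutant \<U>"
  unfolding commutant_def
proof (intro CollectI ballI)
  fix W assume W: "W \<in> \<U>"
  have "T o\<^sub>L W = T o\<^sub>L ((W o\<^sub>L S) o\<^sub>L T)"
    by (simp add: blinfun_compose_assoc inverse_opsD[OF inv])
  also have "\<dots> = W o\<^sub>L T"
    unfolding commutantD[OF S W, symmetric] by (simp add: blinfun_compose_assoc inverse_opsD[OF inv])
  finally show "T o\<^sub>L W = W o\<^sub>L T" .
qed

lemma commutant_adjoint:
  fixes T :: "'h::{real_inner,complete_space} \<Rightarrow>\<^sub>L 'h"
  assumes U: "adjoint_closed \<U>" and T: "T \<in> commutant \<U>"
  shows "blinfun_adjoint T \<in> commutant \<U>"
  unfolding commutant_def
proof (intro CollectI ballI)
  fix W assume "W \<in> \<U>"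
  then have "blinfun_adjoint W \<in> \<U>" using U by (simp add: adjoint_closed_def)
  from commutantD[OF T this, THEN arg_cong[where f = blinfun_adjoint]]
  show "blinfun_adjoint T o\<^sub>L W = W o\<^sub>L blinfun_adjoint T" by (simp add: blinfun_adjoint_compose)
qed

lemma commutant_congruence:
  fixes T M :: "'h::{real_inner,complete_space} \<Rightarrow>\<^sub>L 'h"
  assumes "adjoint_closed \<U>" "T \<in> commutant \<U>" "M \<in> commutant \<U>"
  shows "blinfun_adjoint M o\<^sub>L T o\<^sub>L M \<in> commutant \<U>"
  using assms by (intro commutant_compose commutant_adjoint)

lemma closed_jordan_commutant:
  "closed_jordan (commutant \<U>)"
proof -
  have eq: "commutant \<U> = (\<Inter>W\<in>\<U>. {T. T o\<^sub>L W = W o\<^sub>L T})" by (auto simp: commutant_def)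
  have "closed (commutant \<U>)"
    unfolding eq by (intro closed_INT ballI closed_Collect_eq continuous_intros)
  moreover have "subspace (commutant \<U>)"
    by (auto simp: subspace_def commutant_add commutant_scaleR commutant_def blinfun_compose_bilinear)
  ultimately show ?thesis by (simp add: closed_jordan_def commutant_compose)
qed

lemma closed_jordan_selfadjoint:
  "closed_jordan {T :: 'h::{real_inner,complete_space} \<Rightarrow>\<^sub>L 'h. selfadjoint T}"
proof -
  have "closed {T :: 'h \<Rightarrow>\<^sub>L 'h. blinfun_adjoint T = T}"
    by (intro closed_Collect_eq continuous_intros
        bounded_linear.continuous_on[OF bounded_linear_blinfun_adjoint])
  moreover have "blinfun_adjoint (0 :: 'h \<Rightarrow>\<^sub>L 'h) = 0"
    by (rule blinfun_adjoint_unique) simp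
  ultimately show ?thesis
    by (auto simp: closed_jordan_def selfadjoint_def subspace_def blinfun_adjoint_add
        blinfun_adjoint_scaleR blinfun_adjoint_compose)
qed

text \<open>The closure under squares is \<open>S Y\<^sup>2 = Y\<^sup>* S Y = (Y\<^sup>*)\<^sup>2 S\<close>. For invertible selfadjoint \<open>S\<close> these \<open>Y\<close>
  are the operators that are symmetric with respect to the indefinite form \<open>\<langle>S x, y\<rangle>\<close>.\<close>

lemma closed_jordan_intertwine_adjoint:
  fixes S :: "'h::{real_inner,complete_space} \<Rightarrow>\<^sub>L 'h"
  shows "closed_jordan {Y. S o\<^sub>L Y = blinfun_adjoint Y o\<^sub>L S}"
proof -
  have "closed {Y. S o\<^sub>L Y = blinfun_adjoint Y o\<^sub>L S}"
    by (intro closed_Collect_eq continuous_intros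
        bounded_linear.continuous_on[OF bounded_linear_blinfun_adjoint])
  moreover have "blinfun_adjoint (0 :: 'h \<Rightarrow>\<^sub>L 'h) = 0"
    by (rule blinfun_adjoint_unique) simp
  moreover have "S o\<^sub>L (Y o\<^sub>L Y) = blinfun_adjoint (Y o\<^sub>L Y) o\<^sub>L S"
    if Y: "S o\<^sub>L Y = blinfun_adjoint Y o\<^sub>L S" for Y
  proof -
    have "S o\<^sub>L (Y o\<^sub>L Y) = (S o\<^sub>L Y) o\<^sub>L Y" by (simp only: blinfun_compose_assoc)
    also have "\<dots> = blinfun_adjoint Y o\<^sub>L (S o\<^sub>L Y)"
      by (simp only: Y) (simp only: blinfun_compose_assoc Y)
    finally show ?thesis by (simp add: Y blinfun_adjoint_compose blinfun_compose_assoc)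
  qed
  ultimately show ?thesis
    by (auto simp: closed_jordan_def subspace_def blinfun_adjoint_add
        blinfun_adjoint_scaleR blinfun_compose_bilinear)
qed

text \<open>A member \<open>W\<close> of \<open>\<U>\<close> and its adjoint both preserve \<open>ker L\<close>, so that \<open>W\<close> preserves the orthogonal
  complement as well.\<close>

lemma kernel_projection_in_commutant:
  fixes L P :: "'h::{real_inner,complete_space} \<Rightarrow>\<^sub>L 'h"
  assumes U: "adjoint_closed \<U>" and L: "L \<in> commutant \<U>" and P: "selfadjoint P"
    "range (blinfun_apply P) = {x. blinfun_apply L x = 0}"
    "\<And>x. blinfun_apply L x = 0 \<Longrightarrow> blinfun_apply P x = x"
  shows "P \<in> commutant \<U>"
  unfolding commutant_def
proof (intro CollectI ballI blinfun_eqI)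
  fix W x assume W: "W \<in> \<U>"
  have inv: "blinfun_apply L (blinfun_apply V y) = 0" if "V \<in> \<U>" "blinfun_apply L y = 0" for V y
    using commutantD[OF L that(1), THEN arg_cong[where f = "\<lambda>T. blinfun_apply T y"]] that(2) by simp
  have LP: "blinfun_apply L (blinfun_apply P y) = 0" for y using P(2) by blast
  have sym: "blinfun_apply P y \<bullet> z = y \<bullet> blinfun_apply P z" for y z
    using P(1) by (simp add: selfadjoint_iff_symmetric)
  define d where "d = blinfun_apply P (blinfun_apply W (x - blinfun_apply P x))"
  have "blinfun_apply P (blinfun_apply W (blinfun_apply P x)) = blinfun_apply W (blinfun_apply P x)"
    using inv[OF W LP] P(3) by blast
  then have d: "blinfun_apply P (blinfun_apply W x) - blinfun_apply W (blinfun_apply P x) = d"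
    by (simp add: d_def blinfun.diff_right)
  have Ld: "blinfun_apply L d = 0" by (simp add: d_def LP)
  have "blinfun_adjoint W \<in> \<U>" using U W by (simp add: adjoint_closed_def)
  note Pw = P(3)[OF inv[OF this Ld]]
  have "d \<bullet> d = blinfun_apply W (x - blinfun_apply P x) \<bullet> d"
    by (subst d_def) (simp add: sym P(3)[OF Ld])
  also have "\<dots> = (x - blinfun_apply P x) \<bullet> blinfun_apply P (blinfun_apply (blinfun_adjoint W) d)"
    by (simp add: blinfun_adjoint_inner Pw)
  also have "\<dots> = 0" by (simp add: sym[symmetric] blinfun.diff_right P(3)[OF LP])
  finally have "d = 0" by simp
  then show "blinfun_apply (P o\<^sub>L W) x = blinfun_apply (W o\<^sub>L P) x" using d by simp
qed

lemma kernel_projection_exists: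
  fixes L :: "'h::{real_inner,complete_space} \<Rightarrow>\<^sub>L 'h"
  assumes L: "selfadjoint L" "fredholm L" "L \<in> commutant \<U>" and U: "adjoint_closed \<U>"
  shows "\<exists>P Z. selfadjoint P \<and> finite_rank P \<and> P \<in> commutant \<U> \<and> inverse_ops (L + P) Z"
proof -
  let ?N = "{x. blinfun_apply L x = 0}"
  have "subspace ?N" by (intro linear_subspace_kernel bounded_linear.linear blinfun.bounded_linear_right)
  moreover have "closed ?N" by (intro closed_Collect_eq continuous_intros)
  ultimately obtain P where P: "selfadjoint P" "range (blinfun_apply P) = ?N"
    "\<And>x. blinfun_apply L x = 0 \<Longrightarrow> blinfun_apply P x = x"
    using orthogonal_projection_exists[of ?N] by auto
  moreover have "finite_rank P" using L(2) P(2) by (simp add: finite_rank_def fredholm_def)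
  ultimately show ?thesis
    using kernel_projection_in_commutant[OF U L(3) P]
      selfadjoint_fredholm_plus_kernel_projection_invertible[OF L(1,2) P] by blast
qed

section \<open>Congruence along a path\<close>

abbreviation congruence :: "('h::real_inner \<Rightarrow>\<^sub>L 'h) \<Rightarrow> ('h \<Rightarrow>\<^sub>L 'h) \<Rightarrow> ('h \<Rightarrow>\<^sub>L 'h)" where
  "congruence M T \<equiv> blinfun_adjoint M o\<^sub>L T o\<^sub>L M"

lemma GL_iff_inverse_ops: "T \<in> GL \<longleftrightarrow> (\<exists>S. inverse_ops T S)"
  by (simp add: GL_def inverse_ops_def)

lemma congruence_compose:
  fixes M V T :: "'h::{real_inner,complete_space} \<Rightarrow>\<^sub>L 'h"
  shows "congruence (M o\<^sub>L V) T = congruence V (congruence M T)"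
  by (simp add: blinfun_adjoint_compose blinfun_compose_assoc)

lemma congruence_diff: "congruence M (S - T) = congruence M S - congruence M T"
  by (simp add: blinfun_compose_bilinear)

lemma finite_rank_congruence: "finite_rank T \<Longrightarrow> finite_rank (congruence M T)"
  by (intro finite_rank_compose_right finite_rank_compose_left)

text \<open>With \<open>S = L\<^sub>s + P\<close> invertible, the operator \<open>A = S\<^sup>-\<^sup>1 (L\<^sub>t + P)\<close> is near the identity and satisfies
  \<open>S A = A\<^sup>* S\<close>. Its square root \<open>N\<close> satisfies the same relation, hence
  \<open>N\<^sup>* S N = S N\<^sup>2 = L\<^sub>t + P\<close>, and \<open>M = N\<^sup>-\<^sup>1\<close> carries \<open>L\<^sub>t\<close> to \<open>L\<^sub>s\<close> up to the finite-rank term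
  \<open>P - M\<^sup>* P M\<close>.\<close>

lemma local_congruence_mod_finite_rank:
  fixes L :: "'a::metric_space \<Rightarrow> 'h::{real_inner,complete_space} \<Rightarrow>\<^sub>L 'h"
  assumes U: "adjoint_closed \<U>" and cont: "continuous_on A L"
    and L: "\<And>t. t \<in> A \<Longrightarrow> selfadjoint (L t)" "\<And>t. t \<in> A \<Longrightarrow> L t \<in> commutant \<U>"
    and s: "s \<in> A" "fredholm (L s)"
  shows "\<exists>e>0. \<exists>M. continuous_on (A \<inter> ball s e) M \<and>
    (\<forall>t\<in>A \<inter> ball s e. M t \<in> GL \<inter> commutant \<U> \<and> finite_rank (congruence (M t) (L t) - L s))"
proof -
  obtain P Z where P: "selfadjoint P" "finite_rank P" "P \<in> commutant \<U>"
    and Z: "inverse_ops (L s + P) Z"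
    using kernel_projection_exists[OF L(1)[OF s(1)] s(2) L(2)[OF s(1)] U] by blast
  define S where "S = L s + P"
  have SZ: "inverse_ops S Z" using Z by (simp add: S_def)
  have S: "selfadjoint S" "S \<in> commutant \<U>"
    using L s P by (auto simp: S_def selfadjoint_def blinfun_adjoint_add commutant_add)
  have ZS: "blinfun_adjoint Z o\<^sub>L S = id_blinfun"
    using inverse_opsD(2)[OF inverse_ops_adjoint[OF SZ]] S(1) by (simp add: selfadjoint_def)
  \<comment> \<open>\<open>I - X\<^sub>t\<close> is the operator \<open>A = S\<^sup>-\<^sup>1 (L\<^sub>t + P)\<close>.\<close>
  define X where "X t = Z o\<^sub>L (L s - L t)" for t
  define J where "J = commutant \<U> \<inter> {Y. S o\<^sub>L Y = blinfun_adjoint Y o\<^sub>L S}"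
  have J: "closed_jordan J"
    unfolding J_def
    by (intro closed_jordan_Int closed_jordan_commutant closed_jordan_intertwine_adjoint)
  have XJ: "X t \<in> J" if t: "t \<in> A" for t
  proof -
    have "blinfun_adjoint (X t) o\<^sub>L S = (L s - L t) o\<^sub>L (blinfun_adjoint Z o\<^sub>L S)"
      using L(1)[OF t] L(1)[OF s(1)]
      by (simp add: X_def selfadjoint_def blinfun_adjoint_compose blinfun_adjoint_diff blinfun_compose_assoc)
    then have "S o\<^sub>L X t = blinfun_adjoint (X t) o\<^sub>L S"
      by (simp add: ZS X_def inverse_opsD[OF SZ])
    moreover have "X t \<in> commutant \<U>"
      unfolding X_def using L(2) s(1) t
      by (intro commutant_compose commutant_diff commutant_inverse[OF S(2) SZ]) auto
    ultimately show ?thesis by (simp add: J_def)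
  qed
  have contX: "continuous_on A X" unfolding X_def by (intro continuous_intros cont)
  obtain f and r :: real where r: "r < 1"
    and f: "\<And>X :: 'h \<Rightarrow>\<^sub>L 'h. norm X \<le> 1/2 \<Longrightarrow> norm (f X) \<le> r"
      "\<And>X :: 'h \<Rightarrow>\<^sub>L 'h. norm X \<le> 1/2 \<Longrightarrow>
        (id_blinfun - f X) o\<^sub>L (id_blinfun - f X) = id_blinfun - X"
      "\<And>X :: 'h \<Rightarrow>\<^sub>L 'h. \<And>J. norm X \<le> 1/2 \<Longrightarrow> closed_jordan J \<Longrightarrow> X \<in> J \<Longrightarrow> f X \<in> J"
    and contf: "continuous_on (cball 0 (1/2) :: ('h \<Rightarrow>\<^sub>L 'h) set) f"
    using operator_square_root[of "1/2", where 'h = 'h] by auto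
  have "X s = 0" by (simp add: X_def)
  then obtain e where e: "e > 0" "\<And>t. t \<in> A \<Longrightarrow> dist t s < e \<Longrightarrow> norm (X t) < 1/2"
    using contX s(1) unfolding continuous_on_iff by (metis dist_0_norm dist_commute half_gt_zero_iff zero_less_one)
  let ?A = "A \<inter> ball s e"
  have small: "norm (X t) \<le> 1/2" if "t \<in> ?A" for t
    using e(2)[of t] that by (auto simp: dist_commute less_imp_le)
  define N where "N t = id_blinfun - f (X t)" for t
  have "\<exists>M. inverse_ops (N t) M \<and> norm M \<le> 1 / (1 - r)" if "t \<in> ?A" for t
    unfolding N_def by (rule neumann_inverse[OF f(1)[OF small[OF that]] r])
  then obtain M where NM: "\<And>t. t \<in> ?A \<Longrightarrow> inverse_ops (N t) (M t)"
    and Mbd: "\<And>t. t \<in> ?A \<Longrightarrow> norm (M t) \<le> 1 / (1 - r)" by metis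
  have "continuous_on ?A (\<lambda>t. f (X t))"
    by (rule continuous_on_compose2[OF contf continuous_on_subset[OF contX]]) (use small in auto)
  then have "continuous_on ?A N" unfolding N_def by (intro continuous_intros)
  then have "continuous_on ?A M" using NM Mbd by (rule continuous_on_inverse_ops)
  moreover have "M t \<in> GL \<inter> commutant \<U> \<and> finite_rank (congruence (M t) (L t) - L s)"
    if t: "t \<in> ?A" for t
  proof -
    have tA: "t \<in> A" using t by simp
    have fJ: "f (X t) \<in> J" by (rule f(3)[OF small[OF t] J XJ[OF tA]])
    then have "N t \<in> commutant \<U>"
      unfolding N_def J_def by (intro commutant_diff commutant_id) auto
    then have M: "M t \<in> commutant \<U>" using NM[OF t] by (rule commutant_inverse)
    have "M t \<in> GL" using NM[OF t] inverse_ops_sym unfolding GL_iff_inverse_ops by blast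
    have "S o\<^sub>L N t = blinfun_adjoint (N t) o\<^sub>L S"
      using fJ by (simp add: J_def N_def blinfun_compose_bilinear blinfun_adjoint_diff)
    then have "congruence (N t) S = S o\<^sub>L (N t o\<^sub>L N t)" by (simp add: blinfun_compose_assoc[symmetric])
    also have "N t o\<^sub>L N t = id_blinfun - X t" unfolding N_def by (rule f(2)[OF small[OF t]])
    also have "S o\<^sub>L \<dots> = L t + P"
      by (simp add: X_def blinfun_compose_diff_right inverse_opsD[OF SZ]) (simp add: S_def)
    finally have N: "congruence (N t) S = L t + P" .
    have "congruence (M t) (L t + P) = S"
      unfolding N[symmetric] congruence_compose[symmetric]
      by (simp add: inverse_opsD[OF NM[OF t]])
    then have "congruence (M t) (L t) - L s = P - congruence (M t) P"
      by (simp add: S_def blinfun_compose_bilinear algebra_simps)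
    then have "finite_rank (congruence (M t) (L t) - L s)"
      using P(2) by (simp add: finite_rank_diff finite_rank_congruence)
    then show ?thesis using M \<open>M t \<in> GL\<close> by blast
  qed
  ultimately show ?thesis using e(1) by blast
qed

text \<open>Two families over adjacent intervals are glued by multiplying the second one on the right by the
  constant \<open>M'\<^sub>b\<^sup>-\<^sup>1 M\<^sub>b\<close>: this makes them agree at \<open>b\<close>, and it changes differences of transformed
  operators only by a fixed congruence.\<close>

lemma path_congruence_mod_finite_rank:
  fixes L :: "real \<Rightarrow> 'h::{real_inner,complete_space} \<Rightarrow>\<^sub>L 'h"
  assumes U: "adjoint_closed \<U>" and cont: "continuous_on {0..1} L"
    and L: "\<And>t. t \<in> {0..1} \<Longrightarrow> selfadjoint (L t)" "\<And>t. t \<in> {0..1} \<Longrightarrow> fredholm (L t)"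
      "\<And>t. t \<in> {0..1} \<Longrightarrow> L t \<in> commutant \<U>"
  shows "\<exists>M. continuous_on {0..1} M \<and> (\<forall>t\<in>{0..1}. M t \<in> GL \<inter> commutant \<U>) \<and>
    (\<forall>s\<in>{0..1}. \<forall>t\<in>{0..1}. finite_rank (congruence (M t) (L t) - congruence (M s) (L s)))"
proof -
  \<comment> \<open>Comparing all pairs of parameters, and not only each parameter with a base point, makes the local
    step independent of where the point around which it is centred lies in the interval.\<close>
  define \<Phi> where "\<Phi> a b \<longleftrightarrow> (\<exists>M. continuous_on {a..b} M \<and> (\<forall>t\<in>{a..b}. M t \<in> GL \<inter> commutant \<U>) \<and>
    (\<forall>s\<in>{a..b}. \<forall>t\<in>{a..b}. finite_rank (congruence (M t) (L t) - congruence (M s) (L s))))" for a b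
  have pairwise: "finite_rank (D t - D s)" if "finite_rank (D t - E)" "finite_rank (D s - E)"
    for D :: "real \<Rightarrow> 'h \<Rightarrow>\<^sub>L 'h" and E s t
    using finite_rank_diff[OF that] by simp
  have "(0 :: real) \<le> 1" by simp
  then have "0 \<le> (0::real) \<longrightarrow> (1::real) \<le> 1 \<longrightarrow> \<Phi> 0 1"
  proof (induction rule: Bolzano[where P = "\<lambda>a b. 0 \<le> a \<longrightarrow> b \<le> 1 \<longrightarrow> \<Phi> a b"])
    case (trans a b c)
    show ?case
    proof (intro impI)
      assume "0 \<le> a" "c \<le> 1"
      then have "\<Phi> a b" "\<Phi> b c" using trans by auto
      obtain M where M: "continuous_on {a..b} M" "\<And>t. t \<in> {a..b} \<Longrightarrow> M t \<in> GL \<inter> commutant \<U>"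
        "\<And>s t. s \<in> {a..b} \<Longrightarrow> t \<in> {a..b} \<Longrightarrow>
          finite_rank (congruence (M t) (L t) - congruence (M s) (L s))"
        using \<open>\<Phi> a b\<close> unfolding \<Phi>_def by blast
      obtain M' where M': "continuous_on {b..c} M'" "\<And>t. t \<in> {b..c} \<Longrightarrow> M' t \<in> GL \<inter> commutant \<U>"
        "\<And>s t. s \<in> {b..c} \<Longrightarrow> t \<in> {b..c} \<Longrightarrow>
          finite_rank (congruence (M' t) (L t) - congruence (M' s) (L s))"
        using \<open>\<Phi> b c\<close> unfolding \<Phi>_def by blast
      have b: "b \<in> {a..b}" "b \<in> {b..c}" using trans by auto
      obtain R where R: "inverse_ops (M' b) R" using M'(2)[OF b(2)] by (auto simp: GL_iff_inverse_ops)
      obtain Rb where Rb: "inverse_ops (M b) Rb" using M(2)[OF b(1)] by (auto simp: GL_iff_inverse_ops)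
      define V where "V = R o\<^sub>L M b"
      have V: "inverse_ops V (Rb o\<^sub>L M' b)" "V \<in> commutant \<U>" "M' b o\<^sub>L V = M b"
        unfolding V_def using M(2)[OF b(1)] M'(2)[OF b(2)]
        by (auto simp: inverse_opsD[OF R] intro!: inverse_ops_compose inverse_ops_sym[OF R] Rb
            commutant_compose commutant_inverse[OF _ R])
      define M'' where "M'' t = (if t \<le> b then M t else M' t o\<^sub>L V)" for t
      have "{t \<in> {a..c}. t \<le> b} = {a..b}" "{t \<in> {a..c}. b \<le> t} = {b..c}" using trans by auto
      then have "continuous_on {a..c} M''"
        unfolding M''_def using M(1) M'(1) V(3)
        by (intro continuous_on_cases_le continuous_intros) auto
      moreover have "M'' t \<in> GL \<inter> commutant \<U>" if "t \<in> {a..c}" for t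
      proof (cases "t \<le> b")
        case True
        then show ?thesis using M(2)[of t] that by (simp add: M''_def)
      next
        case False
        then have "M' t \<in> GL \<inter> commutant \<U>" using M'(2)[of t] that by simp
        then show ?thesis
          using V(1,2) False unfolding M''_def GL_iff_inverse_ops Int_iff
          by (auto intro: inverse_ops_compose commutant_compose)
      qed
      moreover have "finite_rank (congruence (M'' t) (L t) - congruence (M b) (L b))"
        if "t \<in> {a..c}" for t
      proof (cases "t \<le> b")
        case True
        then show ?thesis using M(3)[OF b(1), of t] that by (simp add: M''_def)
      next
        case False
        have "congruence (M' t o\<^sub>L V) (L t) - congruence (M b) (L b)
            = congruence V (congruence (M' t) (L t) - congruence (M' b) (L b))"
          unfolding V(3)[symmetric] congruence_compose congruence_diff ..
        moreover have "finite_rank \<dots>"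
          using M'(3)[OF b(2), of t] that False by (intro finite_rank_congruence) auto
        ultimately show ?thesis using False by (simp only: M''_def if_False)
      qed
      ultimately show "\<Phi> a c" unfolding \<Phi>_def using pairwise[of "\<lambda>t. congruence (M'' t) (L t)"] by blast
    qed
  next
    case (local x)
    then have x: "x \<in> {0..1}" by simp
    obtain e M where e: "e > 0" and M: "continuous_on ({0..1} \<inter> ball x e) M"
      "\<And>t. t \<in> {0..1} \<inter> ball x e \<Longrightarrow> M t \<in> GL \<inter> commutant \<U>"
      "\<And>t. t \<in> {0..1} \<inter> ball x e \<Longrightarrow> finite_rank (congruence (M t) (L t) - L x)"
      using local_congruence_mod_finite_rank[OF U cont L(1,3) x L(2)[OF x]] by metis
    have "\<Phi> a b" if ab: "a \<le> x \<and> x \<le> b \<and> b - a < e" "0 \<le> a" "b \<le> 1" for a b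
    proof -
      have sub: "{a..b} \<subseteq> {0..1} \<inter> ball x e" using ab by (auto simp: dist_real_def)
      then have "continuous_on {a..b} M" using M(1) continuous_on_subset by blast
      then show ?thesis
        unfolding \<Phi>_def using M(2,3) sub pairwise[of "\<lambda>t. congruence (M t) (L t)"] by blast
    qed
    then show ?case using e by blast
  qed
  then show ?thesis unfolding \<Phi>_def by simp
qed

section \<open>The sign of an invertible selfadjoint operator\<close>

text \<open>For \<open>X = I - c S\<^sup>2\<close> with small \<open>c\<close> the root \<open>B\<close> of \<open>I - X\<close> is \<open>\<surd>c \<bar>S\<bar>\<close>, and a further root \<open>C\<close> of
  \<open>B\<close> has inverse \<open>R\<close> with \<open>R S R = S / (\<surd>c \<bar>S\<bar>)\<close>. The factor \<open>k\<close> with \<open>k\<^sup>4 = c\<close> turns this into the sign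
  \<open>Q\<close> of \<open>S\<close>, and \<open>S = Q \<bar>S\<bar>\<close> is the polar decomposition.\<close>

lemma sign_congruence:
  fixes S :: "'h::{real_inner,complete_space} \<Rightarrow>\<^sub>L 'h"
  assumes S: "selfadjoint S" "S \<in> commutant \<U>" and SZ: "inverse_ops S Z"
  shows "\<exists>Q M B d. selfadjoint Q \<and> Q o\<^sub>L Q = id_blinfun \<and> Q \<in> commutant \<U> \<and>
    M \<in> GL \<inter> commutant \<U> \<and> congruence M S = Q \<and>
    S = Q o\<^sub>L B \<and> 0 < d \<and> (\<forall>x. d * norm x ^ 2 \<le> blinfun_apply B x \<bullet> x)"
proof -
  have sym: "blinfun_apply S x \<bullet> y = x \<bullet> blinfun_apply S y" for x y
    using S(1) by (simp add: selfadjoint_iff_symmetric)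
  define c where "c = 1 / (norm S ^ 2 + 1)"
  \<comment> \<open>\<open>\<parallel>S x\<parallel>\<^sup>2 \<ge> m \<parallel>x\<parallel>\<^sup>2\<close>; adding \<open>1\<close> to both denominators keeps them positive and gives
    \<open>c m \<le> 1\<close>.\<close>
  define m where "m = 1 / (norm Z ^ 2 + 1)"
  have pos: "0 < norm T ^ 2 + 1" for T :: "'h \<Rightarrow>\<^sub>L 'h" by (rule add_nonneg_pos) auto
  have c: "0 < c" "c \<le> 1" "c * norm S ^ 2 \<le> 1" and m: "0 < m" "m \<le> 1"
    using pos[of S] pos[of Z] by (auto simp: c_def m_def)
  have cm: "0 < c * m" "c * m \<le> 1" using c m by (auto intro: mult_le_one)
  define q where "q = sqrt (1 - c * m)"
  have q: "0 \<le> q" "q < 1" "q ^ 2 = 1 - c * m" using cm by (auto simp: q_def)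
  define X where "X = id_blinfun - c *\<^sub>R (S o\<^sub>L S)"
  have "norm X \<le> q"
  proof (rule norm_blinfun_bound[OF q(1)])
    fix x
    let ?y = "blinfun_apply S x"
    have "norm x ^ 2 \<le> (norm Z * norm ?y) ^ 2"
      using norm_blinfun[of Z ?y] by (intro power_mono) (auto simp: inverse_opsD[OF SZ])
    also have "\<dots> \<le> (norm Z ^ 2 + 1) * norm ?y ^ 2"
      unfolding power_mult_distrib by (intro mult_right_mono) auto
    finally have lower: "m * norm x ^ 2 \<le> norm ?y ^ 2"
      using pos[of Z] by (simp add: m_def pos_divide_le_eq mult.commute)
    have "c * norm (blinfun_apply S ?y) ^ 2 \<le> c * (norm S * norm ?y) ^ 2"
      using c(1) by (intro mult_left_mono power_mono norm_blinfun) auto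
    also have "\<dots> = (c * norm S ^ 2) * norm ?y ^ 2" by (simp add: power_mult_distrib)
    also have "\<dots> \<le> 1 * norm ?y ^ 2" by (rule mult_right_mono[OF c(3)]) simp
    finally have upper: "c * (c * norm (blinfun_apply S ?y) ^ 2) \<le> c * norm ?y ^ 2"
      using c(1) by simp
    have "norm (x - c *\<^sub>R blinfun_apply S ?y) ^ 2
        = norm x ^ 2 - 2 * c * (x \<bullet> blinfun_apply S ?y) + c * (c * norm (blinfun_apply S ?y) ^ 2)"
      unfolding power2_norm_eq_inner by (simp add: inner_diff inner_commute algebra_simps)
    also have "x \<bullet> blinfun_apply S ?y = norm ?y ^ 2" by (simp add: sym[symmetric] power2_norm_eq_inner)
    also have "norm x ^ 2 - 2 * c * norm ?y ^ 2 + c * (c * norm (blinfun_apply S ?y) ^ 2)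
        \<le> norm x ^ 2 - c * (m * norm x ^ 2)"
      using upper mult_left_mono[OF lower, of c] c(1) by linarith
    also have "\<dots> = (q * norm x) ^ 2" by (simp add: power_mult_distrib q(3) algebra_simps)
    finally have "norm (x - c *\<^sub>R blinfun_apply S ?y) \<le> q * norm x"
      by (rule power2_le_imp_le) (use q(1) in simp)
    then show "norm (blinfun_apply X x) \<le> q * norm x"
      by (simp add: X_def blinfun.diff_left blinfun.scaleR_left)
  qed
  \<comment> \<open>The roots inherit from \<open>X\<close> that they lie in the commutant of \<open>\<U>\<close>, commute with \<open>S\<close> and are
    selfadjoint.\<close>
  define J where "J = commutant \<U> \<inter> commutant {S} \<inter> {T :: 'h \<Rightarrow>\<^sub>L 'h. selfadjoint T}"
  have J: "closed_jordan J"
    unfolding J_def by (intro closed_jordan_Int closed_jordan_commutant closed_jordan_selfadjoint)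
  have "S \<in> commutant {S}" by (simp add: commutant_def)
  then have XJ: "X \<in> J"
    using S by (auto simp: J_def X_def selfadjoint_def blinfun_adjoint_diff blinfun_adjoint_scaleR
        blinfun_adjoint_compose
        intro!: commutant_diff commutant_id commutant_scaleR commutant_compose)
  obtain Y r where Y: "r < 1" "norm Y \<le> r" "Y \<in> J"
      "(id_blinfun - Y) o\<^sub>L (id_blinfun - Y) = id_blinfun - X"
    using operator_square_root[OF q(1,2), where 'h = 'h] \<open>norm X \<le> q\<close> J XJ by metis
  have r0: "0 \<le> r" using Y(2) norm_ge_zero order_trans by blast
  obtain W r' where W: "r' < 1" "norm W \<le> r'" "W \<in> J"
      "(id_blinfun - W) o\<^sub>L (id_blinfun - W) = id_blinfun - Y"
    using operator_square_root[OF r0 Y(1), where 'h = 'h] Y(2,3) J by metis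
  define B C where "B = id_blinfun - Y" and "C = id_blinfun - W"
  have BB: "B o\<^sub>L B = c *\<^sub>R (S o\<^sub>L S)" and CC: "C o\<^sub>L C = B"
    using Y(4) W(4) by (simp_all add: B_def C_def X_def)
  have C: "C \<in> commutant \<U>" "C \<in> commutant {S}" "selfadjoint C"
    using W(3) by (auto simp: C_def J_def selfadjoint_def blinfun_adjoint_diff
        intro: commutant_diff commutant_id)
  obtain R where CR: "inverse_ops C R" using neumann_inverse[OF W(2,1)] unfolding C_def by blast
  have R: "R \<in> commutant \<U>" "R \<in> commutant {S}" using C(1,2) CR by (auto intro: commutant_inverse)
  have Radj: "blinfun_adjoint R = R"
  proof -
    have "blinfun_adjoint R o\<^sub>L C = id_blinfun"
      using inverse_opsD(2)[OF inverse_ops_adjoint[OF CR]] C(3) by (simp add: selfadjoint_def)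
    then have "(blinfun_adjoint R o\<^sub>L C) o\<^sub>L R = R" by simp
    then show ?thesis by (simp add: blinfun_compose_assoc inverse_opsD[OF CR])
  qed
  have RS: "R o\<^sub>L S = S o\<^sub>L R" using R(2) by (simp add: commutant_def)
  have RS': "R o\<^sub>L (S o\<^sub>L T) = S o\<^sub>L (R o\<^sub>L T)" for T :: "'h \<Rightarrow>\<^sub>L 'h"
    by (metis RS blinfun_compose_assoc)
  define k where "k = sqrt (sqrt c)"
  have k: "0 < k" "(k * k) * (k * k) = c" using c(1) by (auto simp: k_def)
  define Q where "Q = (k * k) *\<^sub>R (S o\<^sub>L (R o\<^sub>L R))"
  have Qsa: "selfadjoint Q"
    using S(1) by (simp add: Q_def selfadjoint_def blinfun_adjoint_scaleR blinfun_adjoint_compose Radj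
        blinfun_compose_assoc RS RS')
  have "Q o\<^sub>L Q = c *\<^sub>R (S o\<^sub>L (S o\<^sub>L (R o\<^sub>L (R o\<^sub>L (R o\<^sub>L R)))))"
    using k(2) by (simp add: Q_def blinfun_compose_bilinear blinfun_compose_assoc RS' mult.assoc)
  also have "\<dots> = (B o\<^sub>L B) o\<^sub>L (R o\<^sub>L (R o\<^sub>L (R o\<^sub>L R)))"
    by (simp add: BB blinfun_compose_bilinear blinfun_compose_assoc)
  also have "\<dots> = id_blinfun"
    by (simp add: CC[symmetric] blinfun_compose_assoc inverse_opsD[OF CR])
  finally have QQ: "Q o\<^sub>L Q = id_blinfun" .
  have Qcomm: "Q \<in> commutant \<U>"
    unfolding Q_def by (intro commutant_scaleR commutant_compose S(2) R(1))
  define M where "M = k *\<^sub>R R"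
  have M: "M \<in> GL \<inter> commutant \<U>"
  proof
    have "inverse_ops M ((1 / k) *\<^sub>R C)"
      using k(1) by (simp add: inverse_ops_def M_def blinfun_compose_bilinear inverse_opsD[OF CR])
    then show "M \<in> GL" unfolding GL_iff_inverse_ops by blast
    show "M \<in> commutant \<U>" unfolding M_def by (intro commutant_scaleR R(1))
  qed
  have MQ: "congruence M S = Q"
    by (simp add: M_def Q_def blinfun_adjoint_scaleR Radj blinfun_compose_bilinear RS
        blinfun_compose_assoc)
  have SQ: "S = Q o\<^sub>L ((1 / (k * k)) *\<^sub>R B)"
    using k(1) by (simp add: Q_def CC[symmetric] blinfun_compose_bilinear blinfun_compose_assoc
        inverse_opsD[OF CR])
  have coercive: "(1 / (k * k)) * (1 - r) * norm x ^ 2 \<le> blinfun_apply ((1 / (k * k)) *\<^sub>R B) x \<bullet> x" for x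
  proof -
    have "blinfun_apply Y x \<bullet> x \<le> norm (blinfun_apply Y x) * norm x" by (rule norm_cauchy_schwarz)
    also have "\<dots> \<le> (r * norm x) * norm x"
      by (intro mult_right_mono order_trans[OF norm_blinfun mult_right_mono[OF Y(2)]] norm_ge_zero)
    finally have "(1 - r) * norm x ^ 2 \<le> blinfun_apply B x \<bullet> x"
      by (simp add: B_def blinfun.diff_left inner_diff_left power2_norm_eq_inner[symmetric]
          power2_eq_square algebra_simps)
    from mult_left_mono[OF this, of "1 / (k * k)"] show ?thesis
      using k(1) by (simp add: blinfun.scaleR_left)
  qed
  have "0 < (1 / (k * k)) * (1 - r)" using k(1) Y(1) by simp
  then show ?thesis using Qsa QQ Qcomm M MQ SQ coercive by blast
qed

text \<open>The scalar \<open>a\<close> is the spectral parameter. Both signs occur because the essential spectrum has to be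
  kept away from either half-line.\<close>

lemma fredholm_coercive_diff_finite_rank:
  fixes B F :: "'h::{real_inner,complete_space} \<Rightarrow>\<^sub>L 'h"
  assumes d: "0 < d" "\<And>x. d * norm x ^ 2 \<le> blinfun_apply B x \<bullet> x"
    and F: "finite_rank F" and a: "0 \<le> a"
  shows "fredholm (a *\<^sub>R id_blinfun + B - F)" "fredholm (- (a *\<^sub>R id_blinfun + B) - F)"
proof -
  have "d * norm x ^ 2 \<le> blinfun_apply (a *\<^sub>R id_blinfun + B) x \<bullet> x" for x
    using d(2)[of x] a by (simp add: blinfun.add_left blinfun.scaleR_left inner_add_left add_increasing)
  then obtain Z where Z: "inverse_ops (a *\<^sub>R id_blinfun + B) Z" using coercive_invertible[OF d(1)] by blast
  show "fredholm (a *\<^sub>R id_blinfun + B - F)" "fredholm (- (a *\<^sub>R id_blinfun + B) - F)"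
    using fredholm_invertible_diff_finite_rank[OF Z F] fredholm_invertible_diff_finite_rank[OF inverse_ops_uminus[OF Z] F] by auto
qed

text \<open>Were the positive eigenspace of \<open>Q\<close> finite-dimensional, then \<open>L\<close> would agree with \<open>-B\<close> up to finite rank,
  so that \<open>\<mu> - L\<close> would be a finite-rank perturbation of a coercive operator for every \<open>\<mu> \<ge> 0\<close>. The
  negative eigenspace is treated in the same way.\<close>

lemma sign_eigenspaces_infinite_dimensional:
  fixes L P Q B :: "'h::{real_inner,complete_space} \<Rightarrow>\<^sub>L 'h"
  assumes L: "L \<in> FS_i" and P: "finite_rank P" and LP: "L + P = Q o\<^sub>L B"
    and d: "0 < d" "\<And>x. d * norm x ^ 2 \<le> blinfun_apply B x \<bullet> x"
  shows "\<not> finite_rank ((1/2) *\<^sub>R (id_blinfun + Q))" "\<not> finite_rank ((1/2) *\<^sub>R (id_blinfun - Q))"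
proof -
  have FS: "L \<in> FS" using L by (simp add: FS_i_def)
  have L_eq: "L = (Q o\<^sub>L B) - P" using LP by (simp add: eq_diff_eq)
  show "\<not> finite_rank ((1/2) *\<^sub>R (id_blinfun + Q))" (is "\<not> finite_rank ?E")
  proof
    assume E: "finite_rank ?E"
    have F: "finite_rank (2 *\<^sub>R (?E o\<^sub>L B) - P)"
      by (intro finite_rank_diff finite_rank_scaleR finite_rank_compose_right E P)
    have eq: "\<mu> *\<^sub>R id_blinfun - L = \<mu> *\<^sub>R id_blinfun + B - (2 *\<^sub>R (?E o\<^sub>L B) - P)" for \<mu>
      unfolding L_eq by (simp add: blinfun_compose_bilinear algebra_simps)
    have "fredholm (\<mu> *\<^sub>R id_blinfun - L)" if "0 \<le> \<mu>" for \<mu>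
      unfolding eq by (rule fredholm_coercive_diff_finite_rank(1)[OF d F that])
    then have "essential_spectrum L \<subseteq> {..<0}"
      unfolding essential_spectrum_def by (auto simp flip: not_le)
    then show False using L FS by (simp add: FS_i_def FS_minus_def)
  qed
  show "\<not> finite_rank ((1/2) *\<^sub>R (id_blinfun - Q))" (is "\<not> finite_rank ?E")
  proof
    assume E: "finite_rank ?E"
    have F: "finite_rank ((-2) *\<^sub>R (?E o\<^sub>L B) - P)"
      by (intro finite_rank_diff finite_rank_scaleR finite_rank_compose_right E P)
    have eq: "\<mu> *\<^sub>R id_blinfun - L
        = - ((- \<mu>) *\<^sub>R id_blinfun + B) - ((-2) *\<^sub>R (?E o\<^sub>L B) - P)" for \<mu>
      unfolding L_eq by (simp add: blinfun_compose_bilinear algebra_simps)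
    have "fredholm (\<mu> *\<^sub>R id_blinfun - L)" if "\<mu> \<le> 0" for \<mu>
      unfolding eq by (rule fredholm_coercive_diff_finite_rank(2)[OF d F]) (use that in simp)
    then have "essential_spectrum L \<subseteq> {0<..}"
      unfolding essential_spectrum_def by (auto simp flip: not_le)
    then show False using L FS by (simp add: FS_i_def FS_plus_def)
  qed
qed

lemma involution_is_symmetry:
  fixes Q :: "'h::{real_inner,complete_space} \<Rightarrow>\<^sub>L 'h"
  assumes Q: "selfadjoint Q" "Q o\<^sub>L Q = id_blinfun"
    and inf: "\<not> finite_rank ((1/2) *\<^sub>R (id_blinfun + Q))" "\<not> finite_rank ((1/2) *\<^sub>R (id_blinfun - Q))"
  shows "is_symmetry Q"
  unfolding is_symmetry_def
proof (intro exI conjI)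
  let ?P = "(1/2) *\<^sub>R (id_blinfun + Q)"
  have "?P o\<^sub>L ?P = (1/4) *\<^sub>R (2 *\<^sub>R (id_blinfun + Q))"
    by (simp add: blinfun_compose_bilinear Q(2) scaleR_2 algebra_simps)
  then show "orthogonal_projection ?P"
    using Q(1) by (simp add: orthogonal_projection_def selfadjoint_def blinfun_adjoint_scaleR blinfun_adjoint_add)
  have QQ: "blinfun_apply Q (blinfun_apply Q x) = x" for x
    using Q(2)[THEN arg_cong[where f = "\<lambda>T. blinfun_apply T x"]] by simp
  have "{u. blinfun_apply ?P u = 0} = range (blinfun_apply ((1/2) *\<^sub>R (id_blinfun - Q)))"
  proof (intro subset_antisym subsetI)
    fix u assume "u \<in> {u. blinfun_apply ?P u = 0}"
    then have "blinfun_apply Q u = - u"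
      by (simp add: blinfun.bilinear_simps add_eq_0_iff)
    then have "u = blinfun_apply ((1/2) *\<^sub>R (id_blinfun - Q)) u"
      by (simp add: blinfun.bilinear_simps scaleR_2[symmetric])
    then show "u \<in> range (blinfun_apply ((1/2) *\<^sub>R (id_blinfun - Q)))" by blast
  qed (auto simp: blinfun.bilinear_simps QQ simp flip: scaleR_add_right)
  then show "\<not> finite_dimensional {u. blinfun_apply ?P u = 0}" using inf(2) by (simp add: finite_rank_def)
  show "\<not> finite_dimensional (range (blinfun_apply ?P))" using inf(1) by (simp add: finite_rank_def)
  show "Q = ?P - (id_blinfun - ?P)" by (simp add: scaleR_2[symmetric] algebra_simps)
qed

text \<open>Both \<open>1\<close> and \<open>-1\<close> are eigenvalues of infinite multiplicity, so they lie in the essential spectrum.\<close>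

lemma symmetry_in_FS_i:
  fixes Q :: "'h::{real_inner,complete_space} \<Rightarrow>\<^sub>L 'h"
  assumes "is_symmetry Q"
  shows "Q \<in> FS_i"
proof -
  obtain P where P: "selfadjoint P" "P o\<^sub>L P = P"
    and ker: "\<not> finite_dimensional {u. blinfun_apply P u = 0}"
    and range: "\<not> finite_dimensional (range (blinfun_apply P))"
    and Q: "Q = P - (id_blinfun - P)"
    using assms unfolding is_symmetry_def orthogonal_projection_def by blast
  have PP: "blinfun_apply P (blinfun_apply P x) = blinfun_apply P x" for x
    using P(2)[THEN arg_cong[where f = "\<lambda>T. blinfun_apply T x"]] by simp
  have "inverse_ops Q Q"
    by (simp add: Q inverse_ops_def blinfun_compose_bilinear P(2))
  moreover have "selfadjoint Q" using P(1) by (simp add: Q selfadjoint_def blinfun_adjoint_diff)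
  ultimately have "Q \<in> FS" by (simp add: FS_def fredholm_invertible)
  moreover have "-1 \<in> essential_spectrum Q"
  proof -
    have "{u. blinfun_apply ((-1) *\<^sub>R id_blinfun - Q) u = 0} = {u. blinfun_apply P u = 0}"
      by (auto simp: Q blinfun.bilinear_simps simp flip: scaleR_2)
    then show ?thesis using ker by (simp add: essential_spectrum_def fredholm_def)
  qed
  moreover have "1 \<in> essential_spectrum Q"
  proof -
    have "{u. blinfun_apply (1 *\<^sub>R id_blinfun - Q) u = 0} = range (blinfun_apply P)"
    proof (intro subset_antisym subsetI)
      fix u assume "u \<in> {u. blinfun_apply (1 *\<^sub>R id_blinfun - Q) u = 0}"
      then have "2 *\<^sub>R (u - blinfun_apply P u) = 0"
        by (simp add: Q blinfun.bilinear_simps scaleR_2 algebra_simps)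
      then have "u = blinfun_apply P u" by simp
      then show "u \<in> range (blinfun_apply P)" by blast
    qed (auto simp: Q blinfun.bilinear_simps PP)
    then show ?thesis using range by (simp add: essential_spectrum_def fredholm_def)
  qed
  ultimately show ?thesis by (force simp: FS_i_def FS_plus_def FS_minus_def)
qed

section \<open>Reduction to a symmetry plus finite rank\<close>

text \<open>The adjoint of the orthogonal operator of \<open>g\<close> is the operator of \<open>g\<^sup>-\<^sup>1\<close>, so that the operators by
  which the group acts form a set closed under adjoints, and equivariance is membership in its
  commutant.\<close>

lemma equivariant_eq_commutant:
  fixes \<rho> :: "'g \<Rightarrow> 'h::{real_inner,complete_space} \<Rightarrow> 'h"
  assumes "orthogonal_action G X \<rho>"
  shows "\<exists>\<U>. adjoint_closed \<U> \<and> equivariant G \<rho> = commutant \<U>"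
proof (intro exI conjI)
  let ?\<U> = "(\<lambda>g. Blinfun (\<rho> g)) ` carrier G"
  have act: "group_action G UNIV \<rho>" and orth: "\<And>g. g \<in> carrier G \<Longrightarrow> orthogonal_transformation (\<rho> g)"
    using assms by (auto simp: orthogonal_action_def)
  then interpret group_action G UNIV \<rho> by simp
  interpret group G using group_hom group_hom.axioms(1) by blast
  have app: "blinfun_apply (Blinfun (\<rho> g)) = \<rho> g" if g: "g \<in> carrier G" for g
  proof (rule bounded_linear_Blinfun_apply, rule bounded_linear_intro[where K = 1])
    show "\<rho> g (x + y) = \<rho> g x + \<rho> g y" "\<rho> g (r *\<^sub>R x) = r *\<^sub>R \<rho> g x" for x y r
      using orthogonal_transformation_linear[OF orth[OF g]] by (simp_all add: linear_add linear_scale)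
    show "norm (\<rho> g x) \<le> norm x * 1" for x
      using orthogonal_transformation_norm[OF orth[OF g]] by simp
  qed
  have adj: "blinfun_adjoint (Blinfun (\<rho> g)) = Blinfun (\<rho> (inv\<^bsub>G\<^esub> g))" if g: "g \<in> carrier G" for g
  proof (rule blinfun_adjoint_unique)
    fix x y
    have "\<rho> g x \<bullet> y = \<rho> (inv\<^bsub>G\<^esub> g) (\<rho> g x) \<bullet> \<rho> (inv\<^bsub>G\<^esub> g) y"
      using orth[of "inv\<^bsub>G\<^esub> g"] g by (simp add: orthogonal_transformation_def)
    also have "\<rho> (inv\<^bsub>G\<^esub> g) (\<rho> g x) = x" using orbit_sym_aux[OF g UNIV_I refl] .
    finally show "blinfun_apply (Blinfun (\<rho> g)) x \<bullet> y = x \<bullet> blinfun_apply (Blinfun (\<rho> (inv\<^bsub>G\<^esub> g))) y"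
      using g by (simp add: app)
  qed
  then show "adjoint_closed ?\<U>" by (auto simp: adjoint_closed_def)
  show "equivariant G \<rho> = commutant ?\<U>"
  proof (intro subset_antisym subsetI)
    fix T assume "T \<in> equivariant G \<rho>"
    then show "T \<in> commutant ?\<U>"
      by (auto simp: equivariant_def commutant_def app intro!: blinfun_eqI)
  next
    fix T assume T: "T \<in> commutant ?\<U>"
    have "blinfun_apply T (\<rho> g u) = \<rho> g (blinfun_apply T u)" if g: "g \<in> carrier G" for g u
      using commutantD[OF T imageI[OF g], THEN arg_cong[where f = "\<lambda>T. blinfun_apply T u"]]
      by (simp add: app[OF g])
    then show "T \<in> equivariant G \<rho>" by (simp add: equivariant_def)
  qed
qed

text \<open>The congruence that carries \<open>L\<^sub>0\<close> to \<open>Q\<close> modulo finite rank is composed with the family along the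
  path, which keeps \<open>L\<^sub>t\<close> congruent to \<open>L\<^sub>0\<close> modulo finite rank.\<close>

theorem path_congruent_to_symmetry_mod_finite_rank:
  fixes L :: "real \<Rightarrow> 'h::{real_inner,complete_space} \<Rightarrow>\<^sub>L 'h"
  assumes U: "adjoint_closed \<U>" and cont: "continuous_on {0..1} L"
    and L: "\<And>t. t \<in> {0..1} \<Longrightarrow> L t \<in> FS_i \<inter> commutant \<U>"
  shows "\<exists>Q M. is_symmetry Q \<and> Q \<in> commutant \<U> \<and> continuous_on {0..1} M \<and>
    (\<forall>t\<in>{0..1}. M t \<in> GL \<inter> commutant \<U> \<and> finite_rank (congruence (M t) (L t) - Q))"
proof -
  have Lsa: "selfadjoint (L t)" and Lfr: "fredholm (L t)" and Lcomm: "L t \<in> commutant \<U>"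
    if "t \<in> {0..1}" for t
    using L[OF that] by (auto simp: FS_i_def FS_def)
  have 0: "(0::real) \<in> {0..1}" by simp
  obtain P Z where P: "selfadjoint P" "finite_rank P" "P \<in> commutant \<U>"
    and Z: "inverse_ops (L 0 + P) Z"
    using kernel_projection_exists[OF Lsa[OF 0] Lfr[OF 0] Lcomm[OF 0] U] by blast
  have "selfadjoint (L 0 + P)" "L 0 + P \<in> commutant \<U>"
    using Lsa[OF 0] Lcomm[OF 0] P by (auto simp: selfadjoint_def blinfun_adjoint_add commutant_add)
  from sign_congruence[OF this Z] obtain Q V B d
    where Q: "selfadjoint Q" "Q o\<^sub>L Q = id_blinfun" "Q \<in> commutant \<U>"
      and V: "V \<in> GL \<inter> commutant \<U>" "congruence V (L 0 + P) = Q"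
      and B: "L 0 + P = Q o\<^sub>L B" "0 < d" "\<And>x. d * norm x ^ 2 \<le> blinfun_apply B x \<bullet> x" by blast
  have "L 0 \<in> FS_i" using L[OF 0] by blast
  then have sym: "is_symmetry Q"
    using sign_eigenspaces_infinite_dimensional[OF _ P(2) B] Q(1,2) by (intro involution_is_symmetry) auto
  obtain N where N: "continuous_on {0..1} N" "\<And>t. t \<in> {0..1} \<Longrightarrow> N t \<in> GL \<inter> commutant \<U>"
    "\<And>s t. s \<in> {0..1} \<Longrightarrow> t \<in> {0..1} \<Longrightarrow>
      finite_rank (congruence (N t) (L t) - congruence (N s) (L s))"
    using path_congruence_mod_finite_rank[OF U cont Lsa Lfr Lcomm] by metis
  obtain R where R: "inverse_ops (N 0) R" using N(2)[OF 0] by (auto simp: GL_iff_inverse_ops)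
  obtain V' where V': "inverse_ops V V'" using V(1) by (auto simp: GL_iff_inverse_ops)
  define A where "A = R o\<^sub>L V"
  have A: "inverse_ops A (V' o\<^sub>L N 0)" "A \<in> commutant \<U>" "N 0 o\<^sub>L A = V"
    unfolding A_def using N(2)[OF 0] V(1)
    by (auto simp: inverse_opsD[OF R] intro!: inverse_ops_compose inverse_ops_sym[OF R] V'
        commutant_compose commutant_inverse[OF _ R])
  have "continuous_on {0..1} (\<lambda>t. N t o\<^sub>L A)" by (intro continuous_intros N(1))
  moreover have "N t o\<^sub>L A \<in> GL \<inter> commutant \<U> \<and> finite_rank (congruence (N t o\<^sub>L A) (L t) - Q)"
    if t: "t \<in> {0..1}" for t
  proof -
    have "congruence (N t o\<^sub>L A) (L t) - congruence V (L 0)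
        = congruence A (congruence (N t) (L t) - congruence (N 0) (L 0))"
      unfolding A(3)[symmetric] congruence_compose congruence_diff ..
    moreover have "congruence V (L 0) - Q = 0 - congruence V P"
      by (simp add: V(2)[symmetric] blinfun_compose_bilinear)
    ultimately have "congruence (N t o\<^sub>L A) (L t) - Q
        = congruence A (congruence (N t) (L t) - congruence (N 0) (L 0)) - congruence V P"
      by (simp add: algebra_simps)
    moreover have "finite_rank \<dots>"
      by (intro finite_rank_diff finite_rank_congruence N(3) 0 t P(2))
    ultimately have "finite_rank (congruence (N t o\<^sub>L A) (L t) - Q)" by simp
    then show ?thesis
      using N(2)[OF t] A(1,2) unfolding GL_iff_inverse_ops Int_iff
      by (auto intro: inverse_ops_compose commutant_compose)
  qed
  ultimately show ?thesis using sym Q(3) by blast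
qed

theorem theorem4p1:
  fixes G :: "('g, 'e) monoid_scheme" and X :: "'g topology"
    and n :: nat and \<A> :: "'g chart set"
    and \<rho> :: "'g \<Rightarrow> 'h::{real_inner, complete_space} \<Rightarrow> 'h"
    and L :: "real \<Rightarrow> 'h \<Rightarrow>\<^sub>L 'h"
  assumes separable: "separable_space (euclidean :: 'h topology)"
    and infinite_dim: "\<not> finite_dimensional (UNIV :: 'h set)"
    and lie: "compact_lie_group G X n \<A>"
    and action: "orthogonal_action G X \<rho>"
    and L: "path L" "\<forall>t\<in>{0..1}. L t \<in> FS_i \<inter> equivariant G \<rho>"
  shows "\<exists>Q M K.
    is_symmetry Q \<and> Q \<in> FS_i \<inter> equivariant G \<rho> \<and>
    path M \<and> (\<forall>t\<in>{0..1}. M t \<in> GL \<inter> equivariant G \<rho>) \<and>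
    path K \<and> (\<forall>t\<in>{0..1}. K t \<in> KS \<inter> equivariant G \<rho>) \<and>
    (\<forall>t\<in>{0..1}. blinfun_adjoint (M t) o\<^sub>L L t o\<^sub>L M t = Q + K t)"
proof -
  obtain \<U> :: "('h \<Rightarrow>\<^sub>L 'h) set" where U: "adjoint_closed \<U>" and eq: "equivariant G \<rho> = commutant \<U>"
    using equivariant_eq_commutant[OF action] by blast
  have cont: "continuous_on {0..1} L" using L(1) by (simp add: path_def)
  have LU: "\<And>t. t \<in> {0..1} \<Longrightarrow> L t \<in> FS_i \<inter> commutant \<U>" using L(2) eq by blast
  obtain Q M where Q: "is_symmetry Q" "Q \<in> commutant \<U>" and contM: "continuous_on {0..1} M"
    and M: "\<And>t. t \<in> {0..1} \<Longrightarrow> M t \<in> GL \<inter> commutant \<U>"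
      "\<And>t. t \<in> {0..1} \<Longrightarrow> finite_rank (congruence (M t) (L t) - Q)"
    using path_congruent_to_symmetry_mod_finite_rank[OF U cont LU] by blast
  have Qi: "Q \<in> FS_i" by (rule symmetry_in_FS_i[OF Q(1)])
  define K where "K t = congruence (M t) (L t) - Q" for t
  have "continuous_on {0..1} K"
    unfolding K_def
    by (intro continuous_intros contM cont bounded_linear.continuous_on[OF bounded_linear_blinfun_adjoint])
  moreover have "K t \<in> KS \<inter> commutant \<U>" if t: "t \<in> {0..1}" for t
  proof -
    have "selfadjoint (congruence (M t) (L t))" "selfadjoint Q"
      using LU[OF t] Qi by (auto simp: FS_i_def FS_def intro: selfadjoint_congruence)
    then have "selfadjoint (K t)" by (simp add: K_def selfadjoint_def blinfun_adjoint_diff)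
    moreover have "compact_operator (K t)"
      unfolding K_def by (rule finite_rank_imp_compact_operator[OF M(2)[OF t]])
    moreover have "K t \<in> commutant \<U>"
      unfolding K_def using LU[OF t] M(1)[OF t] by (intro commutant_diff commutant_congruence U Q(2)) auto
    ultimately show ?thesis by (simp add: KS_def)
  qed
  moreover have "congruence (M t) (L t) = Q + K t" for t by (simp add: K_def)
  ultimately show ?thesis
    unfolding eq path_def using Q Qi contM M(1) by blast
qed

end
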